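(* Let $(b_0,b_1,\dots,b_m)$ with $b_0=n$ be a characteristic sequence, with associated index set $I$, and let $\{i_1,\dots,i_s\}$ be a finite subset of $I$. Let $Q\in\mathbb{C}[A_{i_1},\dots,A_{i_s}]$ be a polynomial such that for every $\varepsilon\in U_n$ (and all complex values of $A_{i_1},\dots,A_{i_s}$) $$Q(A_{i_1},\dots,A_{i_s})=0\iff Q(\varepsilon^{i_1}A_{i_1},\dots,\varepsilon^{i_s}A_{i_s})=0 .$$ Then there exist a finite subset $\{\gamma_1,\dots,\gamma_t\}$ of $\mathbb{N}^2$ and a polynomial $W\in\mathbb{C}[C_{\gamma_1},\dots,C_{\gamma_t}]$ such that for every $f=\sum_{i,j}c_{ij}X^iY^j\in\widehat{\mathcal{F}}(n,b_1,\dots,b_m)$ and every Puiseux parametrisation $(T^n,\sum_{i\in I}a_iT^i)$ of the curve $f(x,y)=0$, $$Q(a_{i_1},\dots,a_{i_s})=0\iff W(c_{\gamma_1},\dots,c_{\gamma_t})=0 .$$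
   Context: A characteristic sequence is a sequence $(b_0,b_1,\dots,b_m)$ of positive integers with $b_0=n$, $b_1<\dots<b_m$, such that, with $e_k:=\gcd(b_0,\dots,b_k)$, one has $e_0>e_1>\dots>e_m=1$. Put $$I=e_0\mathbb{N}_{+}\cup\bigcup_{i=1}^m\bigl(e_i\mathbb{N}\cap[b_i,+\infty)\bigr),\qquad U_n=\{z\in\mathbb{C}:z^n=1\}.$$ Here $\mathbb{N}$ contains $0$; $A_i$ ($i\in I$) and $C_\gamma$ ($\gamma\in\mathbb{N}^2$) are independent variables. For $\alpha=\sum_{i\ge1}a_iT^i\in\mathbb{C}[[T]]$, $\mathrm{supp}(\alpha)=\{i:a_i\ne0\}$. A pair $(T^n,\alpha(T))$ is a Puiseux parametrisation if $\gcd(\{n\}\cup\mathrm{supp}(\alpha))=1$. Its characteristic is the unique sequence $(b_0,\dots,b_m)$ of positive integers with $b_0=n$, $b_{k+1}=\min(\mathrm{supp}(\alpha)\setminus\gcd(b_0,\dots,b_k)\mathbb{N})$, and $\gcd(b_0,\dots,b_m)=1$. The support of $\alpha$ is then contained in $I$. A Weierstrass polynomial of degree $n$ is $Y^n+c_1(X)Y^{n-1}+\dots+c_n(X)$ with $c_i(X)\in\mathbb{C}[[X]]$ without constant term. If $w$ is an irreducible (in $\mathbb{C}[[X,Y]]$) Weierstrass polynomial of degree $n$, a Puiseux parametrisation of $w(x,y)=0$ is a Puiseux parametrisation $(T^n,\alpha(T))$ with $w(T^n,\alpha(T))=0$; the characteristic of $w$ is the characteristic of any of these. $\mathcal{F}(b_0,\dots,b_m)$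 is the set of irreducible Weierstrass polynomials of characteristic $(b_0,\dots,b_m)$. If $f=\sum c_{ij}X^iY^j\in\mathbb{C}[[X,Y]]$ is irreducible with $c_{0j}=0$ for $j<n$ and $c_{0n}\neq0$ ($n>0$), then by the Weierstrass Preparation Theorem $f=u_fw_f$ with unique $u_f$ invertible and $w_f$ a Weierstrass polynomial of degree $n$. $\widehat{\mathcal{F}}(n,b_1,\dots,b_m)$ is the set of irreducible $f\in\mathbb{C}[[X,Y]]$ for which $w_f$ exists and belongs to $\mathcal{F}(n,b_1,\dots,b_m)$. Puiseux parametrisations of the curve $f(x,y)=0$ are by definition those of $w_f(x,y)=0$. *)

theory Defs
  imports "HOL-Library.Poly_Mapping" "HOL-Computational_Algebra.Computational_Algebra"
begin

text \<open>
  Polynomials with complex coefficients in variables indexed by \<open>'v\<close> are finitely supported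
  maps from monomials (finitely supported exponent vectors) to coefficients.
\<close>

type_synonym 'v cpoly = "('v \<Rightarrow>\<^sub>0 nat) \<Rightarrow>\<^sub>0 complex"

definition cpoly_vars :: "'v cpoly \<Rightarrow> 'v set" where
  "cpoly_vars P = (\<Union>\<mu>\<in>Poly_Mapping.keys P. Poly_Mapping.keys \<mu>)"

definition cpoly_eval :: "'v cpoly \<Rightarrow> ('v \<Rightarrow> complex) \<Rightarrow> complex" where
  "cpoly_eval P a =
     (\<Sum>\<mu>\<in>Poly_Mapping.keys P. Poly_Mapping.lookup P \<mu> *
        (\<Prod>v\<in>Poly_Mapping.keys \<mu>. a v ^ Poly_Mapping.lookup \<mu> v))"

text \<open>A sequence \<open>(b\<^sub>0, \<dots>, b\<^sub>m)\<close> is a list of length \<open>m + 1\<close>.\<close>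

definition gcd_upto :: "nat list \<Rightarrow> nat \<Rightarrow> nat" where
  "gcd_upto b k = Gcd ((!) b ` {..k})"

definition char_seq :: "nat list \<Rightarrow> bool" where
  "char_seq b \<longleftrightarrow>
     b \<noteq> [] \<and>
     (\<forall>k<length b. 0 < b ! k) \<and>
     (\<forall>k. 1 \<le> k \<and> k + 1 < length b \<longrightarrow> b ! k < b ! (k + 1)) \<and>
     (\<forall>k. k + 1 < length b \<longrightarrow> gcd_upto b (k + 1) < gcd_upto b k) \<and>
     gcd_upto b (length b - 1) = 1"

definition index_set :: "nat list \<Rightarrow> nat set" where
  "index_set b =
     {gcd_upto b 0 * k | k. 0 < k} \<union>
     (\<Union>i\<in>{1..<length b}. {gcd_upto b i * k | k. True} \<inter> {b ! i..})"

definition fps_supp :: "complex fps \<Rightarrow> nat set" where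
  "fps_supp \<alpha> = {i. fps_nth \<alpha> i \<noteq> 0}"

definition puiseux_parametrisation :: "nat \<Rightarrow> complex fps \<Rightarrow> bool" where
  "puiseux_parametrisation n \<alpha> \<longleftrightarrow>
     0 < n \<and> fps_nth \<alpha> 0 = 0 \<and> Gcd ({n} \<union> fps_supp \<alpha>) = 1"

text \<open>
  The minimum of \<open>supp \<alpha> - gcd(b\<^sub>0, \<dots>, b\<^sub>k) \<nat>\<close> is required to exist: \<open>b\<^sub>k\<^sub>+\<^sub>1\<close> is a member that
  bounds the set from below.
\<close>

definition has_characteristic :: "nat \<Rightarrow> complex fps \<Rightarrow> nat list \<Rightarrow> bool" where
  "has_characteristic n \<alpha> b \<longleftrightarrow>
     b \<noteq> [] \<and>
     (\<forall>k<length b. 0 < b ! k) \<and>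
     b ! 0 = n \<and>
     (\<forall>k. k + 1 < length b \<longrightarrow>
        (let S = {i \<in> fps_supp \<alpha>. \<not> gcd_upto b k dvd i}
         in b ! (k + 1) \<in> S \<and> (\<forall>i\<in>S. b ! (k + 1) \<le> i))) \<and>
     gcd_upto b (length b - 1) = 1"

text \<open>
  \<open>\<complex>[[X,Y]]\<close> is the type \<^typ>\<open>complex fps fps\<close>, where the outer variable is \<open>Y\<close> and the inner
  one is \<open>X\<close>. Then \<open>\<complex>[[X]][Y]\<close> is \<^typ>\<open>complex fps poly\<close>, embedded by \<^const>\<open>fps_of_poly\<close>.
\<close>

definition coeff_XY :: "complex fps fps \<Rightarrow> nat \<times> nat \<Rightarrow> complex" where
  "coeff_XY f = (\<lambda>(i, j). fps_nth (fps_nth f j) i)"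

definition weierstrass_poly :: "nat \<Rightarrow> complex fps poly \<Rightarrow> bool" where
  "weierstrass_poly n w \<longleftrightarrow>
     degree w = n \<and> lead_coeff w = 1 \<and> (\<forall>k<n. fps_nth (coeff w k) 0 = 0)"

definition subst_param :: "complex fps poly \<Rightarrow> nat \<Rightarrow> complex fps \<Rightarrow> complex fps" where
  "subst_param w n \<alpha> = poly (map_poly (\<lambda>c. fps_compose c (fps_X ^ n)) w) \<alpha>"

definition puiseux_parametrisation_of :: "complex fps poly \<Rightarrow> nat \<Rightarrow> complex fps \<Rightarrow> bool" where
  "puiseux_parametrisation_of w n \<alpha> \<longleftrightarrow>
     weierstrass_poly n w \<and> puiseux_parametrisation n \<alpha> \<and> subst_param w n \<alpha> = 0"

text \<open>
  All Puiseux parametrisations of an irreducible Weierstrass polynomial have the same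
  characteristic, and there is at least one of them; hence the existential quantifier below.
\<close>

definition branch_polys :: "nat list \<Rightarrow> complex fps poly set" where
  "branch_polys b =
     {w. irreducible (fps_of_poly w) \<and> weierstrass_poly (b ! 0) w \<and>
         (\<exists>\<alpha>. puiseux_parametrisation_of w (b ! 0) \<alpha> \<and> has_characteristic (b ! 0) \<alpha> b)}"

text \<open>
  The polynomial \<open>w\<close> with this property is unique, so it may be introduced by an
  existential quantifier.
\<close>

definition is_weierstrass_poly_of :: "complex fps fps \<Rightarrow> complex fps poly \<Rightarrow> bool" where
  "is_weierstrass_poly_of f w \<longleftrightarrow>
     (\<exists>n>0. (\<forall>j<n. coeff_XY f (0, j) = 0) \<and> coeff_XY f (0, n) \<noteq> 0 \<and>
        weierstrass_poly n w \<and> (\<exists>u. u dvd 1 \<and> f = u * fps_of_poly w))"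

definition branches :: "nat list \<Rightarrow> complex fps fps set" where
  "branches b = {f. irreducible f \<and> (\<exists>w. is_weierstrass_poly_of f w \<and> w \<in> branch_polys b)}"

definition puiseux_parametrisation_of_curve ::
    "complex fps fps \<Rightarrow> nat \<Rightarrow> complex fps \<Rightarrow> bool" where
  "puiseux_parametrisation_of_curve f n \<alpha> \<longleftrightarrow>
     (\<exists>w. is_weierstrass_poly_of f w \<and> puiseux_parametrisation_of w n \<alpha>)"

end

theory Submission imports Defs begin

text \<open>
  Let \<open>w\<close> be the Weierstrass polynomial of \<open>f\<close> and \<open>\<alpha> = \<Sum> a\<^sub>i T\<^sup>i\<close> a Puiseux parametrisation. The
  condition \<open>Q(a) = 0\<close> is a polynomial condition on finitely many \<open>a\<^sub>i\<close>. The Puiseux coefficients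
  are eliminated from it one at a time, the one with the largest index first; each elimination
  introduces coefficients of \<open>w\<close>.

  To eliminate \<open>a\<^sub>i\<close>, let \<open>e\<close> be the greatest common divisor of \<open>n\<close> and the \<open>b\<^sub>k < i\<close>. The
  substitutions \<open>T \<mapsto> \<epsilon> T\<close> with \<open>\<epsilon> ^ e = 1\<close> fix every \<open>a\<^sub>j\<close> with \<open>j < i\<close> and multiply \<open>a\<^sub>i\<close> by
  \<open>\<epsilon> ^ i\<close>, which runs through the \<open>q\<close>-th roots of unity for a certain divisor \<open>q\<close> of \<open>e\<close>. Hence no
  more than \<open>a\<^sub>i ^ q\<close> can be a function of \<open>w\<close> and the earlier coefficients, and this power is one:
  in \<open>w(T ^ n, Y) = \<Prod> (Y - \<alpha>(\<epsilon> T))\<close>, the product over the \<open>n\<close>-th roots of unity, insert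
  \<open>Y = \<Sum>\<^bsub>j<i\<^esub> a\<^sub>j T\<^sup>j + z T\<^sup>i\<close>. The factors with \<open>\<epsilon> ^ e = 1\<close> have leading coefficient \<open>z - \<epsilon> ^ i * a\<^sub>i\<close>;
  each of the others has as leading coefficient a nonzero constant times \<open>a\<close> at some
  characteristic exponent \<open>b\<^sub>k < i\<close>, which is not zero. So a coefficient of \<open>w(T ^ n, Y)\<close> at a
  degree that depends only on the characteristic equals \<open>M * (z ^ q - a\<^sub>i ^ q) ^ (e / q)\<close>
  (\<open>subst_param_perturbed_truncation_nth\<close>), where \<open>M\<close> is a monomial without zeros in the earlier
  coefficients. Comparing coefficients in \<open>z\<close> gives \<open>M * a\<^sub>i ^ q\<close> (\<open>puiseux_coeff_power_polyfuns\<close>).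

  Since the zeros of the current condition \<open>P\<close> are invariant under conjugation, \<open>P\<close> may be
  replaced by the product of its conjugates \<open>P(\<dots>, \<epsilon> ^ i * a\<^sub>i)\<close>. This product contains \<open>a\<^sub>i\<close> only
  through \<open>a\<^sub>i ^ q\<close>, and \<open>a\<^sub>i\<close> disappears after multiplication by a power of \<open>M\<close>
  (\<open>eliminate_puiseux_coeff\<close>).

  Finally, the coefficients of \<open>w\<close> are polynomials in the coefficients of \<open>f\<close> and \<open>1 / c\<^bsub>0n\<^esub>\<close>
  (\<open>weierstrass_coeffs_polyfuns\<close>), and this denominator is cleared in the same way.

  Throughout, functions are considered only on the set of curves with a parametrisation of the
  given characteristic, and being polynomial means membership in the algebra generated by the
  coefficient functions there.
\<close>

section \<open>Algebras of polynomial functions\<close>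

text \<open>
  The algebra of functions generated by \<open>G\<close>, where only the values on \<open>D\<close> count. Identities that
  hold at the geometrically meaningful points, but not formally, may thus be used to show that a
  function is polynomial in others.
\<close>
inductive_set polyfuns :: "'x set \<Rightarrow> ('x \<Rightarrow> complex) set \<Rightarrow> ('x \<Rightarrow> complex) set"
  for D :: "'x set" and G :: "('x \<Rightarrow> complex) set" where
  gen: "g \<in> G \<Longrightarrow> g \<in> polyfuns D G"
| const: "(\<lambda>_. c) \<in> polyfuns D G"
| add: "f \<in> polyfuns D G \<Longrightarrow> g \<in> polyfuns D G \<Longrightarrow> (\<lambda>x. f x + g x) \<in> polyfuns D G"
| mult: "f \<in> polyfuns D G \<Longrightarrow> g \<in> polyfuns D G \<Longrightarrow> (\<lambda>x. f x * g x) \<in> polyfuns D G"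
| cong: "f \<in> polyfuns D G \<Longrightarrow> (\<And>x. x \<in> D \<Longrightarrow> h x = f x) \<Longrightarrow> h \<in> polyfuns D G"

lemma polyfuns_cmult: "f \<in> polyfuns D G \<Longrightarrow> (\<lambda>x. c * f x) \<in> polyfuns D G"
  by (rule polyfuns.mult[OF polyfuns.const])

lemma polyfuns_diff:
  assumes "f \<in> polyfuns D G" "g \<in> polyfuns D G"
  shows "(\<lambda>x. f x - g x) \<in> polyfuns D G"
  using polyfuns.add[OF assms(1) polyfuns_cmult[OF assms(2), of "-1"]] by simp

lemma polyfuns_sum:
  assumes "\<And>i. i \<in> I \<Longrightarrow> f i \<in> polyfuns D G"
  shows "(\<lambda>x. \<Sum>i\<in>I. f i x) \<in> polyfuns D G"
  using assms
proof (induction I rule: infinite_finite_induct)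
  case (insert i I)
  then show ?case using polyfuns.add[of "f i" D G "\<lambda>x. \<Sum>i\<in>I. f i x"] by simp
qed (simp_all add: polyfuns.const)

lemma polyfuns_prod:
  assumes "\<And>i. i \<in> I \<Longrightarrow> f i \<in> polyfuns D G"
  shows "(\<lambda>x. \<Prod>i\<in>I. f i x) \<in> polyfuns D G"
  using assms
proof (induction I rule: infinite_finite_induct)
  case (insert i I)
  then show ?case using polyfuns.mult[of "f i" D G "\<lambda>x. \<Prod>i\<in>I. f i x"] by simp
qed (simp_all add: polyfuns.const)

lemma polyfuns_power: "f \<in> polyfuns D G \<Longrightarrow> (\<lambda>x. f x ^ k) \<in> polyfuns D G"
  using polyfuns_prod[of "{..<k}" "\<lambda>_. f"] by simp

lemma polyfuns_subst:
  assumes "f \<in> polyfuns D G" "G \<subseteq> polyfuns D G'"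
  shows "f \<in> polyfuns D G'"
  using assms(1)
  by induction (use assms(2) in \<open>auto intro: polyfuns.intros\<close>)

lemma polyfuns_mono: "f \<in> polyfuns D G \<Longrightarrow> G \<subseteq> G' \<Longrightarrow> f \<in> polyfuns D G'"
  by (erule polyfuns_subst) (auto intro: polyfuns.gen)

lemma polyfuns_pullback:
  assumes "f \<in> polyfuns D G" "\<phi> ` D' \<subseteq> D" "\<And>g. g \<in> G \<Longrightarrow> (\<lambda>x. g (\<phi> x)) \<in> polyfuns D' G'"
  shows "(\<lambda>x. f (\<phi> x)) \<in> polyfuns D' G'"
  using assms(1)
proof induction
  case (cong f h)
  show ?case by (rule polyfuns.cong[OF cong.IH]) (use cong.hyps assms(2) in blast)
qed (auto intro: polyfuns.intros assms(3))

text \<open>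
  Used in two ways: to see that functions of the first Puiseux coefficients are invariant under
  the conjugations that fix these coefficients, and to derive the uniqueness of the Weierstrass
  polynomial from a formula for its coefficients.
\<close>
lemma polyfuns_agree:
  assumes "f \<in> polyfuns D G" "x \<in> D" "y \<in> D" "\<And>g. g \<in> G \<Longrightarrow> g x = g y"
  shows "f x = f y"
  using assms(1) by induction (use assms(2-4) in auto)

lemma polyfuns_insert_expand:
  assumes "f \<in> polyfuns D (insert g G)"
  shows "\<exists>P d. (\<forall>j. P j \<in> polyfuns D G) \<and> (\<forall>x\<in>D. f x = (\<Sum>j\<le>d::nat. P j x * g x ^ j))"
  using assms
proof induction
  case (gen h)
  show ?case
  proof (cases "h = g")
    case True
    then show ?thesis
      by (intro exI[of _ "\<lambda>j _. of_bool (j = 1)"] exI[of _ "1::nat"]) (simp add: polyfuns.const)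
  next
    case False
    then have "h \<in> polyfuns D G" using gen by (auto intro: polyfuns.gen)
    then show ?thesis by (intro exI[of _ "\<lambda>_. h"] exI[of _ "0::nat"]) simp
  qed
next
  case (const c)
  show ?case
    by (intro exI[of _ "\<lambda>_ _. c"] exI[of _ "0::nat"]) (simp add: polyfuns.const)
next
  case (add f h)
  then obtain P d P' d' where P: "\<forall>j. P j \<in> polyfuns D G" "\<forall>j. P' j \<in> polyfuns D G"
    "\<forall>x\<in>D. f x = (\<Sum>j\<le>d::nat. P j x * g x ^ j)" "\<forall>x\<in>D. h x = (\<Sum>j\<le>d'::nat. P' j x * g x ^ j)"
    by blast
  define R where "R j = (\<lambda>x. of_bool (j \<le> d) * P j x + of_bool (j \<le> d') * P' j x)" for j
  have "R j \<in> polyfuns D G" for j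
    unfolding R_def using P by (intro polyfuns.add polyfuns_cmult) auto
  moreover have "f x + h x = (\<Sum>j\<le>max d d'. R j x * g x ^ j)" if "x \<in> D" for x
  proof -
    have "(\<Sum>j\<le>d. P j x * g x ^ j) = (\<Sum>j\<le>max d d'. of_bool (j \<le> d) * P j x * g x ^ j)"
      by (rule sum.mono_neutral_cong_left) auto
    moreover have "(\<Sum>j\<le>d'. P' j x * g x ^ j) = (\<Sum>j\<le>max d d'. of_bool (j \<le> d') * P' j x * g x ^ j)"
      by (rule sum.mono_neutral_cong_left) auto
    ultimately show ?thesis using P that
      by (simp add: R_def distrib_right sum.distrib)
  qed
  ultimately show ?case by blast
next
  case (mult f h)
  then obtain P d P' d' where P: "\<forall>j. P j \<in> polyfuns D G" "\<forall>j. P' j \<in> polyfuns D G"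
    "\<forall>x\<in>D. f x = (\<Sum>j\<le>d::nat. P j x * g x ^ j)" "\<forall>x\<in>D. h x = (\<Sum>j\<le>d'::nat. P' j x * g x ^ j)"
    by blast
  define R where "R k = (\<lambda>x. \<Sum>(i, j) \<in> {p \<in> {..d} \<times> {..d'}. fst p + snd p = k}. P i x * P' j x)" for k
  have "R j \<in> polyfuns D G" for j
    unfolding R_def using P by (auto intro!: polyfuns_sum polyfuns.mult)
  moreover have "f x * h x = (\<Sum>k\<le>d + d'. R k x * g x ^ k)" if "x \<in> D" for x
  proof -
    have "f x * h x = (\<Sum>(i, j) \<in> {..d} \<times> {..d'}. P i x * P' j x * g x ^ (i + j))"
      unfolding P(3)[rule_format, OF that] P(4)[rule_format, OF that] sum_product sum.cartesian_product
      by (intro sum.cong refl) (auto simp: power_add)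
    also have "\<dots> = (\<Sum>k\<le>d + d'. \<Sum>(i, j) \<in> {p \<in> {..d} \<times> {..d'}. fst p + snd p = k}.
                      P i x * P' j x * g x ^ (i + j))"
      by (rule sum.group[symmetric]) auto
    also have "\<dots> = (\<Sum>k\<le>d + d'. R k x * g x ^ k)"
      unfolding R_def sum_distrib_right by (intro sum.cong refl) auto
    finally show ?thesis .
  qed
  ultimately show ?case by blast
next
  case (cong f h)
  then show ?case by simp
qed

text \<open>
  Since \<open>g\<close> has no zeros on \<open>D\<close>, the zero set of \<open>f\<close> is also that of \<open>g ^ N * f\<close>; so a denominator
  without zeros costs nothing when only the vanishing of \<open>f\<close> matters.
\<close>
lemma polyfuns_clear_denominator:
  assumes "f \<in> polyfuns D (insert (\<lambda>x. 1 / g x) G)" "g \<in> polyfuns D G" "\<And>x. x \<in> D \<Longrightarrow> g x \<noteq> 0"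
  obtains N where "(\<lambda>x. g x ^ N * f x) \<in> polyfuns D G"
proof -
  obtain P and d :: nat where P: "\<And>j. P j \<in> polyfuns D G"
    "\<And>x. x \<in> D \<Longrightarrow> f x = (\<Sum>j\<le>d. P j x * (1 / g x) ^ j)"
    using polyfuns_insert_expand[OF assms(1)] by blast
  have "(\<lambda>x. \<Sum>j\<le>d. P j x * g x ^ (d - j)) \<in> polyfuns D G"
    by (intro polyfuns_sum polyfuns.mult polyfuns_power P assms)
  then have "(\<lambda>x. g x ^ d * f x) \<in> polyfuns D G"
  proof (rule polyfuns.cong)
    fix x assume x: "x \<in> D"
    have "g x ^ d * (P j x * (1 / g x) ^ j) = P j x * g x ^ (d - j)" if "j \<le> d" for j
      using assms(3)[OF x] that by (simp add: power_diff field_simps)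
    then show "g x ^ d * f x = (\<Sum>j\<le>d. P j x * g x ^ (d - j))"
      unfolding P(2)[OF x] sum_distrib_left by (intro sum.cong) auto
  qed
  then show ?thesis by (rule that)
qed

section \<open>Evaluation of polynomials\<close>

text \<open>
  The monomial factor of \<open>cpoly_eval\<close>. Evaluation is a ring homomorphism, and therefore membership
  in the generated algebra yields a polynomial.
\<close>
definition eval_monom :: "('v \<Rightarrow>\<^sub>0 nat) \<Rightarrow> ('v \<Rightarrow> complex) \<Rightarrow> complex" where
  "eval_monom \<mu> a = (\<Prod>v\<in>Poly_Mapping.keys \<mu>. a v ^ Poly_Mapping.lookup \<mu> v)"

lemma eval_monom_superset:
  assumes "finite V" "Poly_Mapping.keys \<mu> \<subseteq> V"
  shows "eval_monom \<mu> a = (\<Prod>v\<in>V. a v ^ Poly_Mapping.lookup \<mu> v)"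
  unfolding eval_monom_def
  by (rule prod.mono_neutral_left) (use assms in \<open>auto simp: in_keys_iff\<close>)

lemma eval_monom_add: "eval_monom (\<mu> + \<nu>) a = eval_monom \<mu> a * eval_monom \<nu> a"
proof -
  let ?V = "Poly_Mapping.keys \<mu> \<union> Poly_Mapping.keys \<nu>"
  have "Poly_Mapping.keys (\<mu> + \<nu>) \<subseteq> ?V" by (rule Poly_Mapping.keys_add)
  then show ?thesis
    by (simp add: eval_monom_superset[of ?V] lookup_add power_add prod.distrib)
qed

lemma cpoly_eval_superset:
  assumes "finite S" "Poly_Mapping.keys P \<subseteq> S"
  shows "cpoly_eval P a = (\<Sum>\<mu>\<in>S. Poly_Mapping.lookup P \<mu> * eval_monom \<mu> a)"
  unfolding cpoly_eval_def eval_monom_def[symmetric]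
  by (rule sum.mono_neutral_left) (use assms in \<open>auto simp: in_keys_iff\<close>)

lemma cpoly_eval_add: "cpoly_eval (P + Q) a = cpoly_eval P a + cpoly_eval Q a"
proof -
  let ?S = "Poly_Mapping.keys P \<union> Poly_Mapping.keys Q"
  have "Poly_Mapping.keys (P + Q) \<subseteq> ?S" by (rule Poly_Mapping.keys_add)
  then show ?thesis
    by (simp add: cpoly_eval_superset[of ?S] lookup_add distrib_right sum.distrib)
qed

lemma cpoly_eval_sum: "cpoly_eval (\<Sum>i\<in>I. P i) a = (\<Sum>i\<in>I. cpoly_eval (P i) a)"
  by (induction I rule: infinite_finite_induct)
     (simp_all add: cpoly_eval_add cpoly_eval_def[of 0])

lemma cpoly_eval_single: "cpoly_eval (Poly_Mapping.single \<mu> c) a = c * eval_monom \<mu> a"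
  by (subst cpoly_eval_superset[of "{\<mu>}"]) auto

lemma cpoly_sum_singles:
  "P = (\<Sum>\<mu>\<in>Poly_Mapping.keys P. Poly_Mapping.single \<mu> (Poly_Mapping.lookup P \<mu>))"
  by (rule poly_mapping_eqI)
     (auto simp: lookup_sum lookup_single when_def in_keys_iff)

lemma cpoly_eval_mult: "cpoly_eval (P * Q) a = cpoly_eval P a * cpoly_eval Q a"
proof -
  have "cpoly_eval (P * Q) a = cpoly_eval ((\<Sum>\<mu>\<in>Poly_Mapping.keys P. Poly_Mapping.single \<mu> (Poly_Mapping.lookup P \<mu>)) *
    (\<Sum>\<mu>\<in>Poly_Mapping.keys Q. Poly_Mapping.single \<mu> (Poly_Mapping.lookup Q \<mu>))) a"
    using cpoly_sum_singles[of P] cpoly_sum_singles[of Q] by simp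
  also have "\<dots> = cpoly_eval P a * cpoly_eval Q a"
    by (simp add: sum_product cpoly_eval_sum mult_single cpoly_eval_single eval_monom_add
        cpoly_eval_superset[OF _ subset_refl] mult_ac)
  finally show ?thesis .
qed

lemma polyfuns_imp_cpoly:
  assumes "f \<in> polyfuns D (range (\<lambda>v x. c x v))"
  shows "\<exists>W. \<forall>x\<in>D. f x = cpoly_eval W (c x)"
  using assms
proof induction
  case (gen g)
  then obtain v where v: "g = (\<lambda>x. c x v)" by blast
  have "\<forall>x\<in>D. g x = cpoly_eval (Poly_Mapping.single (Poly_Mapping.single v 1) 1) (c x)"
    by (simp add: v cpoly_eval_single eval_monom_superset[of "{v}"])
  then show ?case by blast
next
  case (const k)
  have "\<forall>x\<in>D. k = cpoly_eval (Poly_Mapping.single 0 k) (c x)"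
    by (simp add: cpoly_eval_single eval_monom_def)
  then show ?case by blast
qed (metis cpoly_eval_add, metis cpoly_eval_mult, metis)

lemma cpoly_eval_in_polyfuns:
  "(\<lambda>x. cpoly_eval Q (a x)) \<in> polyfuns D ((\<lambda>v x. a x v) ` cpoly_vars Q)"
  unfolding cpoly_eval_def
  by (intro polyfuns_sum polyfuns_cmult polyfuns_prod polyfuns_power polyfuns.gen)
     (auto simp: cpoly_vars_def)

section \<open>Roots of unity\<close>

lemma root_of_unity_order:
  fixes \<zeta> :: complex
  assumes "\<zeta> ^ n = 1" "n > 0"
  obtains q where "q > 0" "\<And>j. \<zeta> ^ j = 1 \<longleftrightarrow> q dvd j"
proof
  define q where "q = (LEAST q. q > 0 \<and> \<zeta> ^ q = 1)"
  have q: "q > 0 \<and> \<zeta> ^ q = 1"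
    unfolding q_def by (rule LeastI[of _ n]) (use assms in simp)
  then show "q > 0" by simp
  fix j
  show "\<zeta> ^ j = 1 \<longleftrightarrow> q dvd j"
  proof
    assume "\<zeta> ^ j = 1"
    moreover have "\<zeta> ^ j = \<zeta> ^ (j mod q) * (\<zeta> ^ q) ^ (j div q)"
      unfolding power_mult[symmetric] power_add[symmetric] by simp
    ultimately have "\<zeta> ^ (j mod q) = 1" using q by simp
    moreover have "j mod q < q" using q by simp
    ultimately have "j mod q = 0"
      using not_less_Least[of "j mod q" "\<lambda>q. q > 0 \<and> \<zeta> ^ q = 1"] by (auto simp: q_def)
    then show "q dvd j" by auto
  next
    assume "q dvd j"
    then show "\<zeta> ^ j = 1" using q by (auto simp: power_mult)
  qed
qed

text \<open>
  The order of \<open>\<epsilon>\<close> divides every element of \<open>S\<close>, hence also the greatest common divisor. The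
  element \<open>n\<close> ensures that \<open>\<epsilon>\<close> has finite order.
\<close>
lemma power_Gcd_eq_1:
  fixes \<epsilon> :: complex and S :: "nat set"
  assumes "\<And>s. s \<in> S \<Longrightarrow> \<epsilon> ^ s = 1" "n \<in> S" "n > 0"
  shows "\<epsilon> ^ Gcd S = 1"
proof -
  obtain q where q: "\<And>j. \<epsilon> ^ j = 1 \<longleftrightarrow> q dvd j"
    using root_of_unity_order[of \<epsilon> n] assms by blast
  have "q dvd Gcd S" using assms(1) q by (intro Gcd_greatest) auto
  then show ?thesis by (simp add: q)
qed

lemma cis_root_power_eq_1_iff:
  assumes "m > 0"
  shows "cis (2 * pi / real m) ^ k = 1 \<longleftrightarrow> m dvd k"
proof -
  let ?\<omega> = "cis (2 * pi / real m)"
  have "?\<omega> ^ m = 1" using assms by (simp add: DeMoivre)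
  then obtain q where q: "q > 0" "\<And>j. ?\<omega> ^ j = 1 \<longleftrightarrow> q dvd j"
    using root_of_unity_order assms by blast
  have "q dvd m" using q \<open>?\<omega> ^ m = 1\<close> by blast
  then have "q \<le> m" using assms by (rule dvd_imp_le)
  moreover have "\<not> q < m"
  proof
    assume "q < m"
    have "inj_on (\<lambda>k. cis (2 * pi * real k / real m)) {..<m}"
      using bij_betw_roots_unity[OF assms] by (rule bij_betw_imp_inj_on)
    moreover have "cis (2 * pi * real q / real m) = cis (2 * pi * real 0 / real m)"
      using q(2)[of q] by (simp add: DeMoivre mult_ac)
    ultimately show False using \<open>q < m\<close> q(1) inj_onD[of _ "{..<m}" q 0] by fastforce
  qed
  ultimately show ?thesis using q by simp
qed

lemma roots_of_unity_eq_powers: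
  assumes "m > 0"
  shows "bij_betw (\<lambda>k. cis (2 * pi / real m) ^ k) {..<m} {z. z ^ m = 1}"
  using bij_betw_roots_unity[OF assms]
  by (rule iffD1[OF bij_betw_cong, rotated]) (simp add: DeMoivre mult_ac)

text \<open>
  If \<open>m\<close> does not divide \<open>l\<close>, replacing \<open>\<epsilon>\<close> by \<open>\<omega> * \<epsilon>\<close> for a primitive root \<open>\<omega>\<close> permutes the
  summands and multiplies the sum by \<open>\<omega> ^ l \<noteq> 1\<close>, so the sum vanishes.
\<close>
lemma sum_roots_of_unity_power:
  assumes "m > 0"
  shows "(\<Sum>\<epsilon> | \<epsilon> ^ m = 1. \<epsilon> ^ l) = (if m dvd l then of_nat m else 0 :: complex)"
proof (cases "m dvd l")
  case True
  then have "(\<Sum>\<epsilon> | \<epsilon> ^ m = 1. \<epsilon> ^ l :: complex) = (\<Sum>\<epsilon>\<in>{\<epsilon>::complex. \<epsilon> ^ m = 1}. 1)"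
    by (intro sum.cong) (auto simp: power_mult)
  then show ?thesis using True card_roots_unity_eq[OF assms] by simp
next
  case False
  let ?\<omega> = "cis (2 * pi / real m)"
  let ?S = "\<Sum>\<epsilon> | \<epsilon> ^ m = 1. \<epsilon> ^ l :: complex"
  have \<omega>: "?\<omega> ^ l \<noteq> 1" "?\<omega> ^ m = 1" using False assms by (simp_all add: cis_root_power_eq_1_iff)
  have "?\<omega> ^ l * ?S = (\<Sum>\<epsilon> | \<epsilon> ^ m = 1. (?\<omega> * \<epsilon>) ^ l)"
    by (simp add: sum_distrib_left power_mult_distrib)
  also have "\<dots> = ?S"
    by (rule sum.reindex_bij_witness[of _ "\<lambda>\<epsilon>. \<epsilon> / ?\<omega>" "\<lambda>\<epsilon>. ?\<omega> * \<epsilon>"])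
       (use \<omega>(2) in \<open>auto simp: power_mult_distrib power_divide\<close>)
  finally show ?thesis using \<omega>(1) False by auto
qed

lemma prod_diff_primitive_root_powers:
  fixes \<zeta> a z :: complex
  assumes "q > 0" "\<And>j. \<zeta> ^ j = 1 \<longleftrightarrow> q dvd j"
  shows "(\<Prod>k<q. z - \<zeta> ^ k * a) = z ^ q - a ^ q"
proof (cases "a = 0")
  case False
  have \<zeta>0: "\<zeta> \<noteq> 0" using assms(2)[of q] assms(1) by (cases "\<zeta> = 0") (auto simp: zero_power)
  have inj: "inj_on (\<lambda>k. \<zeta> ^ k * a) {..<q}"
  proof (rule linorder_inj_onI')
    fix i j assume ij: "i \<in> {..<q}" "j \<in> {..<q}" "i < j"
    show "\<zeta> ^ i * a \<noteq> \<zeta> ^ j * a"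
    proof
      assume "\<zeta> ^ i * a = \<zeta> ^ j * a"
      moreover have "\<zeta> ^ j = \<zeta> ^ i * \<zeta> ^ (j - i)" using ij by (simp flip: power_add)
      ultimately have "\<zeta> ^ i * 1 = \<zeta> ^ i * \<zeta> ^ (j - i)" using False by simp
      then have "\<zeta> ^ (j - i) = 1" using \<zeta>0 by simp
      then have "q dvd j - i" using assms(2) by simp
      then show False using ij by (auto dest!: dvd_imp_le)
    qed
  qed
  let ?p = "\<Prod>k<q. [:- (\<zeta> ^ k * a), 1:]" and ?r = "monom 1 q + [:- (a ^ q):]"
  have "degree ?r = degree (monom (1::complex) q)"
    by (rule degree_add_eq_left) (simp add: degree_monom_eq assms(1))
  then have deg: "degree ?r = q" by (simp add: degree_monom_eq)
  have lead: "coeff ?r q = 1" using assms(1) by (simp add: coeff_pCons split: nat.split)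
  have "?p = ?r"
  proof (rule poly_eqI_degree_lead_coeff[of _ q _ "(\<lambda>k. \<zeta> ^ k * a) ` {..<q}"])
    show "card ((\<lambda>k. \<zeta> ^ k * a) ` {..<q}) \<ge> q" by (simp add: card_image[OF inj])
    show "degree ?p \<le> q" by (simp add: degree_prod_eq_sum_degree)
    show "coeff ?p q = coeff ?r q" 
      using lead_coeff_prod[of "\<lambda>k. [:- (\<zeta> ^ k * a), 1:]" "{..<q}"] lead
      by (simp add: degree_prod_eq_sum_degree)
    fix x assume "x \<in> (\<lambda>k. \<zeta> ^ k * a) ` {..<q}"
    then obtain k where k: "k < q" "x = \<zeta> ^ k * a" by auto
    have "x ^ q = a ^ q" using assms(2)[of "k * q"] by (simp add: k power_mult_distrib flip: power_mult)
    then show "poly ?p x = poly ?r x" using k by (auto simp: poly_prod poly_monom)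
  qed (simp add: deg)
  then have "poly ?p z = poly ?r z" by simp
  then show ?thesis by (simp add: poly_prod poly_monom)
qed (use assms(1) in simp)

text \<open>
  The number \<open>q\<close> is the order of \<open>\<zeta> = \<omega> ^ i\<close>, where \<open>\<omega>\<close> is a primitive \<open>e\<close>-th root of unity. As
  \<open>\<epsilon>\<close> runs through the \<open>e\<close>-th roots of unity, \<open>\<epsilon> ^ i\<close> runs \<open>e div q\<close> times through the powers of
  \<open>\<zeta>\<close>, that is, through the roots of \<open>z ^ q - 1\<close>.
\<close>
lemma prod_diff_twisted_roots:
  assumes "e > 0"
  obtains q where "q > 0" "q dvd e" "\<And>j. e dvd i * j \<longleftrightarrow> q dvd j"
    "\<And>a z :: complex. (\<Prod>\<epsilon> | \<epsilon> ^ e = 1. z - \<epsilon> ^ i * a) = (z ^ q - a ^ q) ^ (e div q)"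
proof -
  let ?\<omega> = "cis (2 * pi / real e)"
  define \<zeta> where "\<zeta> = ?\<omega> ^ i"
  have \<zeta>: "\<zeta> ^ j = 1 \<longleftrightarrow> e dvd i * j" for j
    using cis_root_power_eq_1_iff[OF assms, of "i * j"] by (simp add: \<zeta>_def power_mult)
  obtain q where q: "q > 0" "\<And>j. \<zeta> ^ j = 1 \<longleftrightarrow> q dvd j"
    using root_of_unity_order[of \<zeta> e] \<zeta> assms by auto
  have qe: "q dvd e" using q \<zeta>[of e] by simp
  have "(\<Prod>\<epsilon> | \<epsilon> ^ e = 1. z - \<epsilon> ^ i * a) = (z ^ q - a ^ q) ^ (e div q)" for a z :: complex
  proof -
    have "(\<Prod>\<epsilon> | \<epsilon> ^ e = 1. z - \<epsilon> ^ i * a) = (\<Prod>k<e. z - (?\<omega> ^ k) ^ i * a)"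
      by (rule prod.reindex_bij_betw[OF roots_of_unity_eq_powers[OF assms], symmetric])
    also have "\<dots> = (\<Prod>k<(e div q) * q. z - \<zeta> ^ k * a)"
      using qe by (simp add: \<zeta>_def mult.commute flip: power_mult)
    also have "\<dots> = (\<Prod>m<e div q. \<Prod>k\<in>{m * q..<m * q + q}. z - \<zeta> ^ k * a)"
      by (rule prod.nat_group[symmetric])
    also have "\<dots> = (\<Prod>m<e div q. z ^ q - a ^ q)"
    proof (intro prod.cong refl)
      fix m
      have "(\<Prod>k\<in>{m * q..<m * q + q}. z - \<zeta> ^ k * a) = (\<Prod>k<q. z - \<zeta> ^ (k + m * q) * a)"
        by (rule prod.reindex_bij_witness[of _ "\<lambda>k. k + m * q" "\<lambda>k. k - m * q"]) auto
      also have "\<dots> = (\<Prod>k<q. z - \<zeta> ^ k * a)"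
      proof -
        have "\<zeta> ^ (m * q) = 1" using q by simp
        then show ?thesis by (simp add: power_add)
      qed
      also have "\<dots> = z ^ q - a ^ q" by (rule prod_diff_primitive_root_powers[OF q])
      finally show "(\<Prod>k\<in>{m * q..<m * q + q}. z - \<zeta> ^ k * a) = z ^ q - a ^ q" .
    qed
    finally show ?thesis by simp
  qed
  then show ?thesis using that q qe \<zeta> by blast
qed

lemma coeff_eq_sum_roots_of_unity:
  fixes p :: "complex poly"
  assumes "degree p < m" "j < m"
  shows "coeff p j = (\<Sum>\<zeta> | \<zeta> ^ m = 1. \<zeta> ^ (m - j) * poly p \<zeta>) / of_nat m"
proof -
  have m: "m > 0" using assms by simp
  have "poly p \<zeta> = (\<Sum>l<m. coeff p l * \<zeta> ^ l)" for \<zeta>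
    unfolding poly_altdef
    by (rule sum.mono_neutral_left) (use assms in \<open>auto simp: coeff_eq_0\<close>)
  then have "(\<Sum>\<zeta> | \<zeta> ^ m = 1. \<zeta> ^ (m - j) * poly p \<zeta>) =
      (\<Sum>\<zeta> | \<zeta> ^ m = 1. \<Sum>l<m. coeff p l * \<zeta> ^ (m - j + l))"
    by (simp add: sum_distrib_left power_add mult_ac)
  also have "\<dots> = (\<Sum>l<m. coeff p l * (\<Sum>\<zeta> | \<zeta> ^ m = 1. \<zeta> ^ (m - j + l)))"
    by (subst sum.swap) (simp add: sum_distrib_left)
  also have "\<dots> = (\<Sum>l<m. if l = j then coeff p l * of_nat m else 0)"
  proof (intro sum.cong refl)
    fix l assume l: "l \<in> {..<m}"
    have "m dvd m - j + l \<longleftrightarrow> l = j"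
    proof
      assume "m dvd m - j + l"
      then obtain k where k: "m - j + l = m * k" by blast
      moreover have "m - j + l < m * 2" "0 < m - j + l" using l assms by auto
      ultimately have "k = 1" by auto
      then show "l = j" using k assms by simp
    qed (use assms in auto)
    then show "coeff p l * (\<Sum>\<zeta> | \<zeta> ^ m = 1. \<zeta> ^ (m - j + l)) =
               (if l = j then coeff p l * of_nat m else 0)"
      by (simp add: sum_roots_of_unity_power[OF m])
  qed
  also have "\<dots> = coeff p j * of_nat m" using assms by simp
  finally show ?thesis using m by simp
qed

text \<open>
  A coefficient of a polynomial of bounded degree is a fixed linear combination of its values at
  the roots of unity of a sufficiently large order, so a polynomial whose values all lie in the
  algebra has its coefficients there as well.
\<close>
lemma polyfuns_coeff:
  assumes "\<And>t. (\<lambda>x. poly (p x) t) \<in> polyfuns D G" "\<And>x. x \<in> D \<Longrightarrow> degree (p x) \<le> d"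
  shows "(\<lambda>x. coeff (p x) j) \<in> polyfuns D G"
proof -
  define m where "m = Suc (max d j)"
  have "(\<lambda>x. inverse (of_nat m) * (\<Sum>\<zeta> | \<zeta> ^ m = 1. \<zeta> ^ (m - j) * poly (p x) \<zeta>)) \<in> polyfuns D G"
    by (intro polyfuns_cmult polyfuns_sum assms)
  then show ?thesis
  proof (rule polyfuns.cong)
    fix x assume "x \<in> D"
    then have "degree (p x) < m" "j < m" using assms(2)[of x] by (auto simp: m_def)
    then show "coeff (p x) j = inverse (of_nat m) * (\<Sum>\<zeta> | \<zeta> ^ m = 1. \<zeta> ^ (m - j) * poly (p x) \<zeta>)"
      by (subst coeff_eq_sum_roots_of_unity) (auto simp: field_simps)
  qed
qed

lemma complex_nth_root_exists:
  fixes t :: complex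
  assumes "q > 0"
  obtains z where "z ^ q = t"
proof (cases "t = 0")
  case False
  then have "card {z. z ^ q = t} = q" using assms by (rule card_nth_roots)
  then have "{z. z ^ q = t} \<noteq> {}" using assms by fastforce
  then show ?thesis using that by blast
qed (use assms that[of 0] in simp)

text \<open>
  As a polynomial in \<open>t = z ^ q\<close>, the function \<open>M * (t - a ^ q) ^ r\<close> has second highest
  coefficient \<open>- r * M * a ^ q\<close>. This extracts \<open>a ^ q\<close> itself, where the value at \<open>z = 0\<close> would
  give only \<open>a ^ (q * r)\<close>.
\<close>
lemma polyfuns_root_power:
  assumes V: "\<And>z. (\<lambda>x. M x * (z ^ q - a x ^ q) ^ r) \<in> polyfuns D G" and "q > 0" "r > 0"
  shows "(\<lambda>x. M x * a x ^ q) \<in> polyfuns D G"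
proof -
  define p where "p x = smult (M x) ([:- (a x ^ q), 1:] ^ r)" for x
  have "(\<lambda>x. poly (p x) t) \<in> polyfuns D G" for t
  proof -
    obtain z where "z ^ q = t" using complex_nth_root_exists[OF \<open>q > 0\<close>] .
    then show ?thesis using V[of z] by (simp add: p_def poly_power)
  qed
  moreover have "degree (p x) \<le> r" for x
    unfolding p_def by (rule order_trans[OF degree_smult_le]) (simp add: degree_linear_power)
  ultimately have "(\<lambda>x. coeff (p x) (r - 1)) \<in> polyfuns D G"
    by (rule polyfuns_coeff)
  then have "(\<lambda>x. (- inverse (of_nat r)) * coeff (p x) (r - 1)) \<in> polyfuns D G"
    by (rule polyfuns_cmult)
  then show ?thesis
  proof (rule polyfuns.cong)
    fix x
    have "r choose (r - 1) = r" using \<open>r > 0\<close> binomial_symmetric[of "r - 1" r] by simp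
    then have "coeff (p x) (r - 1) = - of_nat r * (M x * a x ^ q)"
      using \<open>r > 0\<close> by (simp add: p_def coeff_linear_poly_power)
    then show "M x * a x ^ q = - inverse (of_nat r) * coeff (p x) (r - 1)"
      using \<open>r > 0\<close> by simp
  qed
qed

section \<open>Coefficients of the Weierstrass polynomial\<close>

text \<open>
  Let \<open>v\<close> be the inverse of the unit, so that \<open>v * f = w\<close>. The coefficient of
  \<open>X ^ i * Y ^ (m + n)\<close> in \<open>w\<close> is 0 or 1. On the other side it is \<open>v\<^bsub>im\<^esub> * c\<^bsub>0n\<^esub>\<close> plus terms that
  involve only those \<open>v\<^bsub>lp\<^esub>\<close> for which \<open>(l, p)\<close> precedes \<open>(i, m)\<close> lexicographically, because
  \<open>c\<^bsub>0j\<^esub> = 0\<close> for \<open>j < n\<close>. This determines \<open>v\<close> recursively, with \<open>c\<^bsub>0n\<^esub>\<close> as the only denominator, and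
  then \<open>w = v * f\<close>.
\<close>
lemma weierstrass_coeffs_polyfuns:
  fixes f :: "'x \<Rightarrow> complex fps fps" and w :: "'x \<Rightarrow> complex fps poly"
  assumes w: "\<And>x. x \<in> D \<Longrightarrow> weierstrass_poly n (w x)"
    and f0: "\<And>x j. x \<in> D \<Longrightarrow> j < n \<Longrightarrow> coeff_XY (f x) (0, j) = 0"
    and fn: "\<And>x. x \<in> D \<Longrightarrow> coeff_XY (f x) (0, n) \<noteq> 0"
    and u: "\<And>x. x \<in> D \<Longrightarrow> \<exists>u. u dvd 1 \<and> f x = u * fps_of_poly (w x)"
  shows "(\<lambda>x. fps_nth (coeff (w x) j) i) \<in>
    polyfuns D (insert (\<lambda>x. 1 / coeff_XY (f x) (0, n)) (range (\<lambda>\<gamma> x. coeff_XY (f x) \<gamma>)))"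
    (is "_ \<in> ?A")
proof -
  have "\<exists>v. v * f x = fps_of_poly (w x)" if x: "x \<in> D" for x
  proof -
    obtain u where "u dvd 1" "f x = u * fps_of_poly (w x)" using u[OF x] by blast
    moreover from \<open>u dvd 1\<close> obtain v where "1 = u * v" by (rule dvdE)
    ultimately have "v * f x = fps_of_poly (w x)" by (metis mult.assoc mult.commute mult_1)
    then show ?thesis by blast
  qed
  then obtain v where v: "\<And>x. x \<in> D \<Longrightarrow> v x * f x = fps_of_poly (w x)" by metis
  have f: "(\<lambda>x. fps_nth (fps_nth (f x) j) i) \<in> ?A" for i j
    by (rule polyfuns.gen) (auto simp: coeff_XY_def intro!: image_eqI[of _ _ "(i, j)"])
  have wv: "fps_nth (coeff (w x) j) i =
      (\<Sum>(p, l)\<in>{..j} \<times> {..i}. fps_nth (fps_nth (v x) p) l * fps_nth (fps_nth (f x) (j - p)) (i - l))"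
    if "x \<in> D" for x i j
  proof -
    have "fps_nth (coeff (w x) j) i = fps_nth (fps_nth (v x * f x) j) i" by (simp add: v[OF that])
    then show ?thesis
      by (simp add: fps_mult_nth[of "v x" "f x"] fps_sum_nth fps_mult_nth[of "fps_nth (v x) p" for p]
          sum.cartesian_product atMost_atLeast0)
  qed
  have v_mem: "(\<lambda>x. fps_nth (fps_nth (v x) m) i) \<in> ?A" for i m
  proof (induction i arbitrary: m rule: less_induct)
    case (less i)
    note IHi = less.IH
    show ?case
    proof (induction m rule: less_induct)
      case (less m)
      note IHm = less.IH
      let ?t = "\<lambda>x (p, l). fps_nth (fps_nth (v x) p) l * fps_nth (fps_nth (f x) (m + n - p)) (i - l)"
      let ?T = "{..m + n} \<times> {..i}"
      have mem: "(\<lambda>x. ?t x (p, l)) \<in> ?A" if pl: "(p, l) \<in> ?T - {(m, i)}" for p l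
      proof -
        consider "l < i" | "l = i" "p < m" | "l = i" "p > m" using pl by fastforce
        then show ?thesis
        proof cases
          case 1
          then show ?thesis using IHi f by (auto intro: polyfuns.mult)
        next
          case 2
          then show ?thesis using IHm f by (auto intro: polyfuns.mult)
        next
          case 3
          show ?thesis
          proof (rule polyfuns.cong[OF polyfuns.const[of 0]])
            fix x assume "x \<in> D"
            then show "?t x (p, l) = 0" using 3 pl f0[of x "m + n - p"] by (auto simp: coeff_XY_def)
          qed
        qed
      qed
      have "(\<lambda>x. (of_bool (m = 0 \<and> i = 0) - (\<Sum>q\<in>?T - {(m, i)}. ?t x q)) * (1 / coeff_XY (f x) (0, n))) \<in> ?A"
        by (intro polyfuns.mult polyfuns_diff polyfuns.const polyfuns_sum)
           (use mem in \<open>auto intro: polyfuns.gen\<close>)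
      then show ?case
      proof (rule polyfuns.cong)
        fix x assume x: "x \<in> D"
        have "coeff (w x) (m + n) = of_bool (m = 0)"
          using w[OF x] by (cases "m = 0") (auto simp: weierstrass_poly_def coeff_eq_0)
        then have "of_bool (m = 0 \<and> i = 0) = (\<Sum>q\<in>?T. ?t x q)"
          using wv[OF x, of "m + n" i] by (cases "m = 0") auto
        also have "\<dots> = ?t x (m, i) + (\<Sum>q\<in>?T - {(m, i)}. ?t x q)"
          by (rule sum.remove) auto
        finally show "fps_nth (fps_nth (v x) m) i =
          (of_bool (m = 0 \<and> i = 0) - (\<Sum>q\<in>?T - {(m, i)}. ?t x q)) * (1 / coeff_XY (f x) (0, n))"
          using fn[OF x] by (simp add: coeff_XY_def field_simps)
      qed
    qed
  qed
  have "(\<lambda>x. \<Sum>q\<in>{..j} \<times> {..i}. (case q of (p, l) \<Rightarrow>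
      fps_nth (fps_nth (v x) p) l * fps_nth (fps_nth (f x) (j - p)) (i - l))) \<in> ?A"
    by (intro polyfuns_sum) (use v_mem f in \<open>auto intro: polyfuns.mult\<close>)
  then show ?thesis by (rule polyfuns.cong) (rule wv)
qed

text \<open>
  The coefficients of \<open>w\<close> are functions of the coefficients of \<open>f\<close>.
\<close>
lemma is_weierstrass_poly_of_unique:
  assumes "is_weierstrass_poly_of f w" "is_weierstrass_poly_of f w'"
  shows "w = w'"
proof -
  obtain n where n: "\<forall>j<n. coeff_XY f (0, j) = 0" "coeff_XY f (0, n) \<noteq> 0"
    "weierstrass_poly n w" "\<exists>u. u dvd 1 \<and> f = u * fps_of_poly w"
    using assms(1) unfolding is_weierstrass_poly_of_def by blast
  obtain n' where n': "\<forall>j<n'. coeff_XY f (0, j) = 0" "coeff_XY f (0, n') \<noteq> 0"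
    "weierstrass_poly n' w'" "\<exists>u. u dvd 1 \<and> f = u * fps_of_poly w'"
    using assms(2) unfolding is_weierstrass_poly_of_def by blast
  have "n' = n" using n(1,2) n'(1,2) by (metis linorder_neqE_nat)
  have "fps_nth (coeff w j) i = fps_nth (coeff w' j) i" for i j
    by (rule polyfuns_agree[OF weierstrass_coeffs_polyfuns[of "{w, w'}" n "\<lambda>x. x" "\<lambda>_. f"]])
       (use n n' \<open>n' = n\<close> in auto)
  then show ?thesis by (intro poly_eqI fps_ext) 
qed

section \<open>Conjugate Puiseux parametrisations\<close>

text \<open>
  The substitution \<open>T \<mapsto> \<epsilon> T\<close>. For \<open>\<epsilon> ^ n = 1\<close> it fixes \<open>T ^ n\<close>, and therefore sends Puiseux
  parametrisations of \<open>w\<close> to Puiseux parametrisations of \<open>w\<close>.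
\<close>
definition twist :: "complex \<Rightarrow> complex fps \<Rightarrow> complex fps" where
  "twist \<epsilon> \<alpha> = fps_compose \<alpha> (fps_const \<epsilon> * fps_X)"

lemma twist_nth [simp]: "fps_nth (twist \<epsilon> \<alpha>) j = \<epsilon> ^ j * fps_nth \<alpha> j"
  by (simp add: twist_def)

lemma twist_twist: "twist \<epsilon> (twist \<eta> \<alpha>) = twist (\<epsilon> * \<eta>) \<alpha>"
  by (rule fps_ext) (simp add: power_mult_distrib)

lemma twist_one [simp]: "twist 1 \<alpha> = \<alpha>"
  by (rule fps_ext) simp

lemma subst_param_altdef:
  "subst_param w n \<beta> = (\<Sum>k\<le>degree w. fps_compose (coeff w k) (fps_X ^ n) * \<beta> ^ k)"
proof -
  let ?p = "map_poly (\<lambda>c. fps_compose c (fps_X ^ n)) w"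
  have "degree ?p \<le> degree w" by (rule map_poly_degree_leq)
  then have "poly ?p \<beta> = (\<Sum>k\<le>degree w. coeff ?p k * \<beta> ^ k)"
    unfolding poly_altdef
    by (intro sum.mono_neutral_left) (auto simp: coeff_eq_0)
  then show ?thesis by (simp add: subst_param_def coeff_map_poly)
qed

lemma subst_param_twist:
  assumes "\<epsilon> ^ n = 1" "n > 0"
  shows "subst_param w n (twist \<epsilon> \<alpha>) = twist \<epsilon> (subst_param w n \<alpha>)"
proof -
  have "twist \<epsilon> (fps_compose c (fps_X ^ n)) = fps_compose c (fps_X ^ n)" for c
    by (rule fps_ext) (use assms in \<open>auto simp: fps_nth_compose_X_power power_mult\<close>)
  then show ?thesis
    unfolding subst_param_altdef
    by (simp add: twist_def fps_compose_sum_distrib fps_compose_mult_distrib fps_compose_power)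
qed

lemma fps_supp_twist: "\<epsilon> \<noteq> 0 \<Longrightarrow> fps_supp (twist \<epsilon> \<alpha>) = fps_supp \<alpha>"
  by (simp add: fps_supp_def)

lemma has_characteristic_twist:
  "\<epsilon> \<noteq> 0 \<Longrightarrow> has_characteristic n (twist \<epsilon> \<alpha>) b \<longleftrightarrow> has_characteristic n \<alpha> b"
  by (simp add: has_characteristic_def fps_supp_twist)

lemma puiseux_parametrisation_of_twist:
  assumes "\<epsilon> ^ n = 1" "puiseux_parametrisation_of w n \<alpha>"
  shows "puiseux_parametrisation_of w n (twist \<epsilon> \<alpha>)"
proof -
  have "n > 0" using assms(2) by (simp add: puiseux_parametrisation_of_def puiseux_parametrisation_def)
  then have "\<epsilon> \<noteq> 0" using assms(1) by (auto simp: zero_power)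
  moreover have "twist \<epsilon> 0 = 0" by (rule fps_ext) simp
  ultimately show ?thesis
    using assms \<open>n > 0\<close>
    by (simp add: puiseux_parametrisation_of_def puiseux_parametrisation_def fps_supp_twist
        subst_param_twist)
qed

text \<open>
  If two twists agree, the quotient of the two roots of unity raised to \<open>n\<close>, or to any exponent in
  the support of \<open>\<alpha>\<close>, is 1, and these exponents have greatest common divisor 1.
\<close>
lemma inj_on_twist:
  assumes "puiseux_parametrisation n \<alpha>"
  shows "inj_on (\<lambda>\<epsilon>. twist \<epsilon> \<alpha>) {\<epsilon>. \<epsilon> ^ n = 1}"
proof (rule inj_onI)
  fix \<epsilon> \<eta> assume *: "\<epsilon> \<in> {\<epsilon>. \<epsilon> ^ n = 1}" "\<eta> \<in> {\<epsilon>. \<epsilon> ^ n = 1}" "twist \<epsilon> \<alpha> = twist \<eta> \<alpha>"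
  have n: "n > 0" "Gcd ({n} \<union> fps_supp \<alpha>) = 1" using assms by (auto simp: puiseux_parametrisation_def)
  have "\<eta> \<noteq> 0" using * n by (auto simp: zero_power)
  have "(\<epsilon> / \<eta>) ^ Gcd ({n} \<union> fps_supp \<alpha>) = 1"
  proof (rule power_Gcd_eq_1[of _ _ n])
    fix s assume "s \<in> {n} \<union> fps_supp \<alpha>"
    moreover have "\<epsilon> ^ s * fps_nth \<alpha> s = \<eta> ^ s * fps_nth \<alpha> s"
      using arg_cong[OF *(3), of "\<lambda>f. fps_nth f s"] by simp
    ultimately show "(\<epsilon> / \<eta>) ^ s = 1"
      using * \<open>\<eta> \<noteq> 0\<close> by (auto simp: fps_supp_def power_divide)
  qed (use n in auto)
  then show "\<epsilon> = \<eta>" using n \<open>\<eta> \<noteq> 0\<close> by simp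
qed

text \<open>
  The twists of \<open>\<alpha>\<close> are \<open>n\<close> distinct roots of the monic polynomial \<open>w(T ^ n, Y)\<close> of degree \<open>n\<close>.
\<close>
lemma subst_param_eq_prod:
  assumes "puiseux_parametrisation_of w n \<alpha>"
  shows "subst_param w n \<beta> = (\<Prod>\<epsilon> | \<epsilon> ^ n = 1. \<beta> - twist \<epsilon> \<alpha>)"
proof -
  let ?U = "{\<epsilon>::complex. \<epsilon> ^ n = 1}"
  let ?p = "map_poly (\<lambda>c. fps_compose c (fps_X ^ n)) w" and ?r = "\<Prod>\<epsilon>\<in>?U. [:- twist \<epsilon> \<alpha>, 1:]"
  have w: "degree w = n" "coeff w n = 1" and \<alpha>: "puiseux_parametrisation n \<alpha>"
    and n: "n > 0"
    using assms by (auto simp: puiseux_parametrisation_of_def weierstrass_poly_def puiseux_parametrisation_def)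
  have card: "card ?U = n" using n by (rule card_roots_unity_eq)
  have deg: "degree ?r = n" by (simp add: degree_prod_eq_sum_degree card)
  have "?p = ?r"
  proof (rule poly_eqI_degree_lead_coeff[of _ n _ "(\<lambda>\<epsilon>. twist \<epsilon> \<alpha>) ` ?U"])
    show "card ((\<lambda>\<epsilon>. twist \<epsilon> \<alpha>) ` ?U) \<ge> n"
      using inj_on_twist[OF \<alpha>] card by (simp add: card_image)
    show "degree ?p \<le> n" using map_poly_degree_leq[of _ w] w by simp
    show "degree ?r \<le> n" using deg by simp
    show "coeff ?p n = coeff ?r n"
      using lead_coeff_prod[of "\<lambda>\<epsilon>. [:- twist \<epsilon> \<alpha>, 1:]" ?U] deg w by (simp add: coeff_map_poly)
    fix x assume "x \<in> (\<lambda>\<epsilon>. twist \<epsilon> \<alpha>) ` ?U"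
    then obtain \<epsilon> where \<epsilon>: "\<epsilon> \<in> ?U" "x = twist \<epsilon> \<alpha>" by auto
    have "poly ?p x = 0"
      using puiseux_parametrisation_of_twist[of \<epsilon> n w \<alpha>] assms \<epsilon>
      by (simp add: puiseux_parametrisation_of_def subst_param_def)
    moreover have "poly ?r x = 0"
      using \<epsilon> finite_roots_unity[of n, where ?'a = complex] n by (auto simp: poly_prod prod_zero_iff)
    ultimately show "poly ?p x = poly ?r x" by simp
  qed
  then show ?thesis by (simp add: subst_param_def poly_prod)
qed

lemma puiseux_parametrisations_conjugate:
  assumes "puiseux_parametrisation_of w n \<alpha>" "puiseux_parametrisation_of w n \<beta>"
  obtains \<epsilon> where "\<epsilon> ^ n = 1" "\<beta> = twist \<epsilon> \<alpha>"
proof -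
  have n: "n > 0" using assms by (auto simp: puiseux_parametrisation_of_def puiseux_parametrisation_def)
  have "(\<Prod>\<epsilon> | \<epsilon> ^ n = 1. \<beta> - twist \<epsilon> \<alpha>) = 0"
    using assms(2) subst_param_eq_prod[OF assms(1), of \<beta>] by (simp add: puiseux_parametrisation_of_def)
  then obtain \<epsilon> where "\<epsilon> ^ n = 1" "\<beta> - twist \<epsilon> \<alpha> = 0"
    using finite_roots_unity[of n, where ?'a = complex] n by (auto simp: prod_zero_iff)
  then show ?thesis using that by auto
qed

section \<open>Recovering a Puiseux coefficient from the preceding ones\<close>

lemma fps_prod_nth_leading:
  fixes F :: "'i \<Rightarrow> 'a::comm_ring_1 fps"
  assumes "finite A" "\<And>a j. a \<in> A \<Longrightarrow> j < d a \<Longrightarrow> fps_nth (F a) j = 0"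
  shows "fps_nth (\<Prod>a\<in>A. F a) (\<Sum>a\<in>A. d a) = (\<Prod>a\<in>A. fps_nth (F a) (d a))
    \<and> (\<forall>j<(\<Sum>a\<in>A. d a). fps_nth (\<Prod>a\<in>A. F a) j = 0)"
  using assms
proof (induction A rule: finite_induct)
  case (insert a A)
  let ?G = "\<Prod>a\<in>A. F a" and ?N = "\<Sum>a\<in>A. d a"
  have IH: "fps_nth ?G ?N = (\<Prod>a\<in>A. fps_nth (F a) (d a))" "\<And>j. j < ?N \<Longrightarrow> fps_nth ?G j = 0"
    using insert by auto
  have F: "fps_nth (F a) j = 0" if "j < d a" for j using insert.prems that by auto
  have zero: "fps_nth (F a) l * fps_nth ?G (j - l) = 0" if "j \<le> d a + ?N" "l \<noteq> d a \<or> j \<noteq> d a + ?N" "l \<le> j" for l j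
  proof (cases "l < d a")
    case False
    then have "j - l < ?N" using that by auto
    then show ?thesis using IH by simp
  qed (simp add: F)
  have "fps_nth (F a * ?G) (d a + ?N) = (\<Sum>l\<in>{0..d a + ?N}. if l = d a then fps_nth (F a) (d a) * fps_nth ?G ?N else 0)"
    unfolding fps_mult_nth by (intro sum.cong refl) (use zero[of "d a + ?N"] in auto)
  then have "fps_nth (F a * ?G) (d a + ?N) = fps_nth (F a) (d a) * fps_nth ?G ?N" by simp
  moreover have "fps_nth (F a * ?G) j = 0" if "j < d a + ?N" for j
    unfolding fps_mult_nth using zero[of j] that by (intro sum.neutral) auto
  ultimately show ?case using insert.hyps IH by simp
qed simp

text \<open>
  Suppose \<open>a\<^sub>j \<noteq> 0\<close> and \<open>\<epsilon> ^ j \<noteq> 1\<close>. If \<open>\<epsilon>\<close> has order dividing \<open>b\<^sub>0, \<dots>, b\<^sub>k\<close>, then \<open>e\<^sub>k\<close> does not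
  divide \<open>j\<close>, so \<open>j\<close> competes for the minimum that defines \<open>b\<^bsub>k+1\<^esub>\<close>. Thus \<open>b\<^bsub>k+1\<^esub> \<le> j\<close>, and the order
  divides \<open>b\<^bsub>k+1\<^esub>\<close> too. At the end of the sequence, \<open>e\<^sub>m = 1\<close> yields \<open>\<epsilon> = 1\<close>.
\<close>
lemma twist_fixes_coeff:
  assumes "has_characteristic n \<alpha> b" "\<epsilon> ^ n = 1" "\<And>k. k < length b \<Longrightarrow> b ! k \<le> j \<Longrightarrow> \<epsilon> ^ (b ! k) = 1"
  shows "\<epsilon> ^ j * fps_nth \<alpha> j = fps_nth \<alpha> j"
proof (rule ccontr)
  assume *: "\<epsilon> ^ j * fps_nth \<alpha> j \<noteq> fps_nth \<alpha> j"
  have b: "b \<noteq> []" "b ! 0 = n" "n > 0" "gcd_upto b (length b - 1) = 1"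
    using assms(1) by (auto simp: has_characteristic_def)
  have gcd_fix: "\<epsilon> ^ gcd_upto b k = 1" if "\<forall>l\<le>k. \<epsilon> ^ (b ! l) = 1" for k
    unfolding gcd_upto_def by (rule power_Gcd_eq_1[of _ _ n]) (use that b in \<open>auto intro: image_eqI[of _ _ 0]\<close>)
  have fix_all: "k < length b \<longrightarrow> (\<forall>l\<le>k. \<epsilon> ^ (b ! l) = 1)" for k
  proof (induction k)
    case (Suc k)
    show ?case
    proof
      assume k: "Suc k < length b"
      then have IH: "\<forall>l\<le>k. \<epsilon> ^ (b ! l) = 1" using Suc by simp
      have "\<not> gcd_upto b k dvd j"
        using gcd_fix[OF IH] * by (auto simp: power_mult)
      moreover have "j \<in> fps_supp \<alpha>" using * by (auto simp: fps_supp_def)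
      ultimately have "b ! Suc k \<le> j"
        using assms(1) k by (auto simp: has_characteristic_def Let_def)
      then show "\<forall>l\<le>Suc k. \<epsilon> ^ (b ! l) = 1" using IH assms(3) k by (auto simp: le_Suc_eq)
    qed
  qed (use assms b in simp)
  have "\<epsilon> ^ gcd_upto b (length b - 1) = 1"
    using fix_all[of "length b - 1"] b by (intro gcd_fix) simp
  then show False using * b by simp
qed

lemma characteristic_exponent_nonzero:
  assumes "has_characteristic n \<alpha> b" "k < length b" "k \<noteq> 0"
  shows "fps_nth \<alpha> (b ! k) \<noteq> 0"
  using assms by (cases k) (auto simp: has_characteristic_def Let_def fps_supp_def)

text \<open>
  For \<open>\<epsilon> ^ (b ! 0) = 1\<close>, the order of \<open>\<Sum>\<^bsub>j<i\<^esub> a\<^sub>j T\<^sup>j + z T\<^sup>i - \<alpha>(\<epsilon> T)\<close> for generic \<open>z\<close>. It depends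
  only on the characteristic: either \<open>\<alpha>\<close> and \<open>\<alpha>(\<epsilon> T)\<close> differ already at some \<open>b\<^sub>k < i\<close>, or the
  order is \<open>i\<close>.
\<close>
definition twist_order :: "nat list \<Rightarrow> nat \<Rightarrow> complex \<Rightarrow> nat" where
  "twist_order b i \<epsilon> = Min (insert i {b ! k | k. k < length b \<and> b ! k < i \<and> \<epsilon> ^ (b ! k) \<noteq> 1})"

text \<open>
  The roots of unity whose order divides this number are those \<open>b ! 0\<close>-th roots of unity whose
  twist fixes all Puiseux coefficients of index less than \<open>i\<close>.
\<close>
definition gcd_below :: "nat list \<Rightarrow> nat \<Rightarrow> nat" where
  "gcd_below b i = Gcd (insert (b ! 0) {b ! k | k. k < length b \<and> b ! k < i})"

lemma root_gcd_below_iff: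
  assumes "b ! 0 > 0"
  shows "\<epsilon> ^ gcd_below b i = (1::complex) \<longleftrightarrow>
    \<epsilon> ^ (b ! 0) = 1 \<and> (\<forall>k<length b. b ! k < i \<longrightarrow> \<epsilon> ^ (b ! k) = 1)"
proof
  assume *: "\<epsilon> ^ gcd_below b i = 1"
  have "\<epsilon> ^ s = 1" if "s \<in> insert (b ! 0) {b ! k | k. k < length b \<and> b ! k < i}" for s
  proof -
    have "gcd_below b i dvd s" unfolding gcd_below_def using that by (rule Gcd_dvd)
    then show ?thesis using * by (auto simp: power_mult)
  qed
  then show "\<epsilon> ^ (b ! 0) = 1 \<and> (\<forall>k<length b. b ! k < i \<longrightarrow> \<epsilon> ^ (b ! k) = 1)" by blast
qed (unfold gcd_below_def, rule power_Gcd_eq_1[of _ _ "b ! 0"], use assms in auto)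

lemma gcd_below_pos: "b ! 0 > 0 \<Longrightarrow> gcd_below b i > 0"
  by (simp add: gcd_below_def gcd_nat.neutr_eq_iff)

lemma twist_order_le: "twist_order b i \<epsilon> \<le> i"
  by (simp add: twist_order_def)

lemma twist_order_eq:
  assumes "b ! 0 > 0" "\<epsilon> ^ gcd_below b i = 1"
  shows "twist_order b i \<epsilon> = i"
proof -
  have "{b ! k | k. k < length b \<and> b ! k < i \<and> \<epsilon> ^ (b ! k) \<noteq> 1} = {}"
    using root_gcd_below_iff[OF assms(1)] assms(2) by auto
  then show ?thesis by (simp only: twist_order_def Min_singleton)
qed

lemma twist_order_less:
  assumes "b ! 0 > 0" "\<epsilon> ^ (b ! 0) = 1" "\<epsilon> ^ gcd_below b i \<noteq> 1"
  obtains k where "k < length b" "k \<noteq> 0" "twist_order b i \<epsilon> = b ! k" "b ! k < i" "\<epsilon> ^ (b ! k) \<noteq> 1"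
proof -
  let ?S = "{b ! k | k. k < length b \<and> b ! k < i \<and> \<epsilon> ^ (b ! k) \<noteq> 1}"
  obtain l where l: "l < length b" "b ! l < i" "\<epsilon> ^ (b ! l) \<noteq> 1"
    using assms root_gcd_below_iff[OF assms(1)] by blast
  then have "twist_order b i \<epsilon> \<le> b ! l"
    unfolding twist_order_def by (intro Min_le) auto
  then have "twist_order b i \<epsilon> \<noteq> i" using l by simp
  moreover have "twist_order b i \<epsilon> \<in> insert i ?S"
    unfolding twist_order_def by (rule Min_in) auto
  ultimately have "twist_order b i \<epsilon> \<in> ?S" by blast
  then obtain k where k: "k < length b" "twist_order b i \<epsilon> = b ! k" "b ! k < i" "\<epsilon> ^ (b ! k) \<noteq> 1"
    by blast
  moreover have "k \<noteq> 0" using k(4) assms(2) by (cases "k = 0") simp_all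
  ultimately show ?thesis using that by blast
qed

text \<open>
  To be substituted for \<open>Y\<close> in \<open>w(T ^ n, Y)\<close>. The free parameter \<open>z\<close> makes the \<open>i\<close>-th coefficient
  of \<open>\<alpha>\<close>, which the truncation does not contain, visible in the result.
\<close>
definition perturbed_truncation :: "nat \<Rightarrow> complex \<Rightarrow> complex fps \<Rightarrow> complex fps" where
  "perturbed_truncation i z \<alpha> = Abs_fps (\<lambda>j. if j < i then fps_nth \<alpha> j else if j = i then z else 0)"

text \<open>
  The leading coefficient of the product of those factors of \<open>w(T ^ n, Y)\<close> whose root differs from
  \<open>\<alpha>\<close> before degree \<open>i\<close>, evaluated at a series that agrees with \<open>\<alpha>\<close> up to there. It is a constant
  times a monomial in the coefficients \<open>a\<close> at the \<open>b\<^sub>k < i\<close>.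
\<close>
definition cofactor_coeff :: "nat list \<Rightarrow> nat \<Rightarrow> complex fps \<Rightarrow> complex" where
  "cofactor_coeff b i \<alpha> =
    (\<Prod>\<epsilon> | \<epsilon> ^ (b ! 0) = 1 \<and> \<epsilon> ^ gcd_below b i \<noteq> 1.
       fps_nth \<alpha> (twist_order b i \<epsilon>) * (1 - \<epsilon> ^ twist_order b i \<epsilon>))"

lemma cofactor_coeff_nonzero:
  assumes "has_characteristic n \<alpha> b"
  shows "cofactor_coeff b i \<alpha> \<noteq> 0"
proof -
  have b: "b ! 0 = n" "n > 0" using assms by (auto simp: has_characteristic_def)
  have "fps_nth \<alpha> (twist_order b i \<epsilon>) * (1 - \<epsilon> ^ twist_order b i \<epsilon>) \<noteq> 0"
    if \<epsilon>: "\<epsilon> ^ (b ! 0) = 1" "\<epsilon> ^ gcd_below b i \<noteq> 1" for \<epsilon>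
  proof -
    obtain k where "k < length b" "k \<noteq> 0" "twist_order b i \<epsilon> = b ! k" "\<epsilon> ^ (b ! k) \<noteq> 1"
      using twist_order_less[of b \<epsilon> i] \<epsilon> b by blast
    then show ?thesis using characteristic_exponent_nonzero[OF assms] by simp
  qed
  moreover have "finite {\<epsilon>::complex. \<epsilon> ^ (b ! 0) = 1 \<and> \<epsilon> ^ gcd_below b i \<noteq> 1}"
    by (rule finite_subset[OF _ finite_roots_unity[of n]]) (use b in auto)
  ultimately show ?thesis unfolding cofactor_coeff_def by (auto simp: prod_zero_iff)
qed

text \<open>
  In \<open>w(T ^ n, \<beta>) = \<Prod> (\<beta> - \<alpha>(\<epsilon> T))\<close> each factor is replaced by its leading term. The factors with
  \<open>\<epsilon> ^ e = 1\<close>, \<open>e = gcd_below b i\<close>, contribute \<open>(z - \<epsilon> ^ i * a\<^sub>i) T\<^sup>i\<close>; the others differ from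
  \<open>\<alpha>(T) - \<alpha>(\<epsilon> T)\<close> only at degrees \<open>\<ge> i\<close>, so their leading terms do not involve \<open>z\<close>. The degree at
  which the coefficient is taken is the sum of these orders and does not depend on \<open>\<alpha>\<close>.
\<close>
lemma subst_param_perturbed_truncation_nth:
  assumes "puiseux_parametrisation_of w n \<alpha>" "has_characteristic n \<alpha> b"
  shows "fps_nth (subst_param w n (perturbed_truncation i z \<alpha>)) (\<Sum>\<epsilon> | \<epsilon> ^ n = 1. twist_order b i \<epsilon>)
    = cofactor_coeff b i \<alpha> * (\<Prod>\<epsilon> | \<epsilon> ^ gcd_below b i = 1. z - \<epsilon> ^ i * fps_nth \<alpha> i)"
proof -
  let ?U = "{\<epsilon>::complex. \<epsilon> ^ n = 1}" and ?H = "{\<epsilon>::complex. \<epsilon> ^ gcd_below b i = 1}"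
  let ?F = "\<lambda>\<epsilon>. perturbed_truncation i z \<alpha> - twist \<epsilon> \<alpha>"
  let ?d = "twist_order b i"
  have b: "b ! 0 = n" "n > 0" using assms(2) by (auto simp: has_characteristic_def)
  have fin: "finite ?U" using finite_roots_unity[of n] b by simp
  have "fps_nth (\<Prod>\<epsilon>\<in>?U. ?F \<epsilon>) (\<Sum>\<epsilon>\<in>?U. ?d \<epsilon>) = (\<Prod>\<epsilon>\<in>?U. fps_nth (?F \<epsilon>) (?d \<epsilon>))"
  proof (rule conjunct1[OF fps_prod_nth_leading[OF fin]])
    fix \<epsilon> j assume *: "\<epsilon> \<in> ?U" "j < ?d \<epsilon>"
    have "j < i" using * twist_order_le[of b i \<epsilon>] by simp
    moreover have "\<epsilon> ^ j * fps_nth \<alpha> j = fps_nth \<alpha> j"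
    proof (rule twist_fixes_coeff[OF assms(2)])
      fix k assume k: "k < length b" "b ! k \<le> j"
      show "\<epsilon> ^ (b ! k) = 1"
      proof (rule ccontr)
        assume "\<epsilon> ^ (b ! k) \<noteq> 1"
        then have "?d \<epsilon> \<le> b ! k"
          unfolding twist_order_def using k \<open>j < i\<close> by (intro Min_le) auto
        then show False using k * by simp
      qed
    qed (use * in simp)
    ultimately show "fps_nth (?F \<epsilon>) j = 0" by (simp add: perturbed_truncation_def)
  qed
  also have "\<dots> = (\<Prod>\<epsilon>\<in>?U - ?H. fps_nth (?F \<epsilon>) (?d \<epsilon>)) * (\<Prod>\<epsilon>\<in>?H. fps_nth (?F \<epsilon>) (?d \<epsilon>))"
    using root_gcd_below_iff[of b _ i] b by (intro prod.subset_diff fin) auto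
  also have "?U - ?H = {\<epsilon>. \<epsilon> ^ (b ! 0) = 1 \<and> \<epsilon> ^ gcd_below b i \<noteq> 1}" using b by auto
  also have "(\<Prod>\<epsilon>\<in>\<dots>. fps_nth (?F \<epsilon>) (?d \<epsilon>)) = cofactor_coeff b i \<alpha>"
    unfolding cofactor_coeff_def
  proof (intro prod.cong refl)
    fix \<epsilon> :: complex assume "\<epsilon> \<in> {\<epsilon>. \<epsilon> ^ (b ! 0) = 1 \<and> \<epsilon> ^ gcd_below b i \<noteq> 1}"
    then obtain k where "?d \<epsilon> = b ! k" "b ! k < i"
      using twist_order_less[of b \<epsilon> i] b by blast
    then have "?d \<epsilon> < i" by simp
    then show "fps_nth (?F \<epsilon>) (?d \<epsilon>) = fps_nth \<alpha> (?d \<epsilon>) * (1 - \<epsilon> ^ ?d \<epsilon>)"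
      by (simp add: perturbed_truncation_def algebra_simps)
  qed
  also have "(\<Prod>\<epsilon>\<in>?H. fps_nth (?F \<epsilon>) (?d \<epsilon>)) = (\<Prod>\<epsilon>\<in>?H. z - \<epsilon> ^ i * fps_nth \<alpha> i)"
  proof (intro prod.cong refl)
    fix \<epsilon> assume "\<epsilon> \<in> ?H"
    then have "?d \<epsilon> = i" using twist_order_eq[of b \<epsilon> i] b by simp
    then show "fps_nth (?F \<epsilon>) (?d \<epsilon>) = z - \<epsilon> ^ i * fps_nth \<alpha> i"
      by (simp add: perturbed_truncation_def)
  qed
  finally show ?thesis unfolding subst_param_eq_prod[OF assms(1)] .
qed

lemma polyfuns_fps_mult:
  assumes "\<And>j. (\<lambda>x. fps_nth (F x) j) \<in> polyfuns D G" "\<And>j. (\<lambda>x. fps_nth (H x) j) \<in> polyfuns D G"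
  shows "(\<lambda>x. fps_nth (F x * H x) j) \<in> polyfuns D G"
  unfolding fps_mult_nth by (intro polyfuns_sum polyfuns.mult assms)

lemma polyfuns_fps_power:
  assumes "\<And>j. (\<lambda>x. fps_nth (F x) j) \<in> polyfuns D G"
  shows "(\<lambda>x. fps_nth (F x ^ k) j) \<in> polyfuns D G"
proof (induction k arbitrary: j)
  case 0
  show ?case by (simp add: polyfuns.const)
next
  case (Suc k)
  show ?case unfolding power_Suc by (rule polyfuns_fps_mult[OF assms Suc])
qed

lemma polyfuns_subst_param:
  assumes "\<And>x. x \<in> D \<Longrightarrow> degree (w x) = d" "n > 0"
    and w: "\<And>k m. (\<lambda>x. fps_nth (coeff (w x) k) m) \<in> polyfuns D G"
    and \<beta>: "\<And>j. (\<lambda>x. fps_nth (\<beta> x) j) \<in> polyfuns D G"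
  shows "(\<lambda>x. fps_nth (subst_param (w x) n (\<beta> x)) N) \<in> polyfuns D G"
proof -
  have *: "(\<lambda>x. fps_nth (fps_compose (coeff (w x) k) (fps_X ^ n)) m) \<in> polyfuns D G" for k m
    using w polyfuns.const[of 0] by (cases "n dvd m") (simp_all add: fps_nth_compose_X_power)
  have "(\<lambda>x. \<Sum>k\<le>d. fps_nth (fps_compose (coeff (w x) k) (fps_X ^ n) * \<beta> x ^ k) N) \<in> polyfuns D G"
    by (rule polyfuns_sum, rule polyfuns_fps_mult[OF *], rule polyfuns_fps_power[OF \<beta>])
  then show ?thesis
    by (rule polyfuns.cong) (simp add: subst_param_altdef assms(1) fps_sum_nth)
qed

section \<open>Elimination of the Puiseux coefficients\<close>

definition parametrised_branches :: "nat list \<Rightarrow> (complex fps poly \<times> complex fps) set" where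
  "parametrised_branches b =
    {(w, \<alpha>). puiseux_parametrisation_of w (b ! 0) \<alpha> \<and> has_characteristic (b ! 0) \<alpha> b}"

text \<open>
  Points are pairs \<open>(w, \<alpha>)\<close>; the generators are all coefficients of \<open>w\<close> and the Puiseux
  coefficients of index less than \<open>i\<close>. The case \<open>i = 0\<close> leaves the coefficients of \<open>w\<close> alone.
\<close>
definition coeff_funs :: "nat \<Rightarrow> (complex fps poly \<times> complex fps \<Rightarrow> complex) set" where
  "coeff_funs i = range (\<lambda>(k, m) (w, \<alpha>). fps_nth (coeff w k) m) \<union> (\<lambda>j (w, \<alpha>). fps_nth \<alpha> j) ` {..<i}"

lemma poly_coeff_in_polyfuns: "(\<lambda>(w, \<alpha>). fps_nth (coeff w k) m) \<in> polyfuns D (coeff_funs i)"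
  by (rule polyfuns.gen) (auto simp: coeff_funs_def intro!: image_eqI[of _ _ "(k, m)"])

lemma puiseux_coeff_in_polyfuns: "j < i \<Longrightarrow> (\<lambda>(w, \<alpha>). fps_nth \<alpha> j) \<in> polyfuns D (coeff_funs i)"
  by (rule polyfuns.gen) (auto simp: coeff_funs_def)

lemma coeff_funs_Suc: "coeff_funs (Suc i) = insert (\<lambda>(w, \<alpha>). fps_nth \<alpha> i) (coeff_funs i)"
  by (auto simp: coeff_funs_def lessThan_Suc)

definition conj_act :: "complex \<Rightarrow> complex fps poly \<times> complex fps \<Rightarrow> complex fps poly \<times> complex fps" where
  "conj_act \<epsilon> = (\<lambda>(w, \<alpha>). (w, twist \<epsilon> \<alpha>))"

lemma conj_act_mem:
  assumes "x \<in> parametrised_branches b" "\<epsilon> ^ (b ! 0) = 1"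
  shows "conj_act \<epsilon> x \<in> parametrised_branches b"
proof -
  have "b ! 0 > 0" using assms(1) by (auto simp: parametrised_branches_def has_characteristic_def)
  then have "\<epsilon> \<noteq> 0" using assms(2) by (auto simp: zero_power)
  then show ?thesis
    using assms by (auto simp: parametrised_branches_def conj_act_def puiseux_parametrisation_of_twist
        has_characteristic_twist)
qed

lemma polyfuns_conj_invariant:
  assumes "h \<in> polyfuns (parametrised_branches b) (coeff_funs i)" "x \<in> parametrised_branches b"
    and "b ! 0 > 0" "\<epsilon> ^ gcd_below b i = 1"
  shows "h (conj_act \<epsilon> x) = h x"
proof (rule polyfuns_agree[OF assms(1)])
  have \<epsilon>: "\<epsilon> ^ (b ! 0) = 1" "\<And>k. k < length b \<Longrightarrow> b ! k < i \<Longrightarrow> \<epsilon> ^ (b ! k) = 1"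
    using assms(4) root_gcd_below_iff[OF assms(3)] by auto
  then show "conj_act \<epsilon> x \<in> parametrised_branches b" using assms(2) by (intro conj_act_mem)
  obtain w \<alpha> where x: "x = (w, \<alpha>)" by fastforce
  have "\<epsilon> ^ j * fps_nth \<alpha> j = fps_nth \<alpha> j" if "j < i" for j
    by (rule twist_fixes_coeff[of "b ! 0" _ b])
       (use assms(2) \<epsilon> that in \<open>auto simp: x parametrised_branches_def\<close>)
  then show "g (conj_act \<epsilon> x) = g x" if "g \<in> coeff_funs i" for g
    using that by (auto simp: coeff_funs_def x conj_act_def)
qed (fact assms(2))

lemma cofactor_coeff_polyfuns:
  assumes "b ! 0 > 0"
  shows "(\<lambda>(w, \<alpha>). cofactor_coeff b i \<alpha>) \<in> polyfuns D (coeff_funs i)"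
proof -
  have "(\<lambda>x. \<Prod>\<epsilon> | \<epsilon> ^ (b ! 0) = 1 \<and> \<epsilon> ^ gcd_below b i \<noteq> 1.
      (case x of (w, \<alpha>) \<Rightarrow> fps_nth \<alpha> (twist_order b i \<epsilon>)) * (1 - \<epsilon> ^ twist_order b i \<epsilon>)) \<in> polyfuns D (coeff_funs i)"
  proof (intro polyfuns_prod polyfuns.mult polyfuns.const)
    fix \<epsilon> :: complex assume "\<epsilon> \<in> {\<epsilon>. \<epsilon> ^ (b ! 0) = 1 \<and> \<epsilon> ^ gcd_below b i \<noteq> 1}"
    then obtain k where "twist_order b i \<epsilon> = b ! k" "b ! k < i"
      using twist_order_less[of b \<epsilon> i] assms by blast
    then show "(\<lambda>(w, \<alpha>). fps_nth \<alpha> (twist_order b i \<epsilon>)) \<in> polyfuns D (coeff_funs i)"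
      by (intro puiseux_coeff_in_polyfuns) simp
  qed
  then show ?thesis by (rule polyfuns.cong) (auto simp: cofactor_coeff_def)
qed

text \<open>
  For each \<open>z\<close>, substituting the perturbed truncation into \<open>w\<close> gives a function of the
  coefficients of \<open>w\<close> and of \<open>a\<^sub>j\<close>, \<open>j < i\<close>. The coefficient of the resulting series at a certain
  degree is \<open>M * (z ^ q - a\<^sub>i ^ q) ^ r\<close> by the product formula for roots of unity, and from these
  values for all \<open>z\<close> one obtains \<open>M * a\<^sub>i ^ q\<close>. Here \<open>q > 1\<close> is possible only when
  \<open>e = gcd_below b i\<close> does not divide \<open>i\<close>. If then \<open>a\<^sub>i \<noteq> 0\<close>, \<open>i\<close> is a characteristic exponent, and
  \<open>a\<^sub>i\<close> is determined only up to a \<open>q\<close>-th root of unity.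
\<close>
lemma puiseux_coeff_power_polyfuns:
  assumes "b ! 0 > 0"
  obtains q where "q > 0" "\<And>j. gcd_below b i dvd i * j \<longleftrightarrow> q dvd j"
    "(\<lambda>(w, \<alpha>). cofactor_coeff b i \<alpha> * fps_nth \<alpha> i ^ q) \<in> polyfuns (parametrised_branches b) (coeff_funs i)"
proof -
  let ?D = "parametrised_branches b" and ?e = "gcd_below b i"
  let ?N = "\<Sum>\<epsilon> | \<epsilon> ^ (b ! 0) = 1. twist_order b i \<epsilon>"
  have e: "?e > 0" using gcd_below_pos[OF assms] .
  obtain q where q: "q > 0" "q dvd ?e" "\<And>j. ?e dvd i * j \<longleftrightarrow> q dvd j"
    "\<And>a z :: complex. (\<Prod>\<epsilon> | \<epsilon> ^ ?e = 1. z - \<epsilon> ^ i * a) = (z ^ q - a ^ q) ^ (?e div q)"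
    using prod_diff_twisted_roots[OF e, of i] by blast
  have "(\<lambda>x. cofactor_coeff b i (snd x) * fps_nth (snd x) i ^ q) \<in> polyfuns ?D (coeff_funs i)"
  proof (rule polyfuns_root_power[OF _ q(1)])
    show "?e div q > 0" using q(1,2) e by (auto dest: dvd_imp_le simp: div_greater_zero_iff)
    fix z
    have "(\<lambda>x. fps_nth (subst_param (fst x) (b ! 0) (perturbed_truncation i z (snd x))) ?N)
        \<in> polyfuns ?D (coeff_funs i)"
    proof (rule polyfuns_subst_param[OF _ assms])
      fix j
      have "(\<lambda>x. fps_nth (snd x) j) \<in> polyfuns ?D (coeff_funs i)" if "j < i"
        using puiseux_coeff_in_polyfuns[OF that] by (simp add: case_prod_unfold)
      then show "(\<lambda>x. fps_nth (perturbed_truncation i z (snd x)) j) \<in> polyfuns ?D (coeff_funs i)"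
        by (cases "j < i") (simp_all add: perturbed_truncation_def polyfuns.const)
    qed (use poly_coeff_in_polyfuns in \<open>auto simp: case_prod_unfold parametrised_branches_def
           puiseux_parametrisation_of_def weierstrass_poly_def\<close>)
    then show "(\<lambda>x. cofactor_coeff b i (snd x) * (z ^ q - fps_nth (snd x) i ^ q) ^ (?e div q))
        \<in> polyfuns ?D (coeff_funs i)"
      by (rule polyfuns.cong)
         (auto simp: parametrised_branches_def subst_param_perturbed_truncation_nth q(4))
  qed
  then show ?thesis using that q by (simp add: case_prod_unfold)
qed

text \<open>
  The product \<open>R\<close> of the conjugates of \<open>P\<close> under the group \<open>H\<close> that fixes \<open>a\<^sub>j\<close> for \<open>j < i\<close> has the
  same zeros as \<open>P\<close> and is invariant under \<open>H\<close>. Written as a polynomial in \<open>a\<^sub>i\<close> and averaged over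
  \<open>H\<close>, it keeps only the powers of \<open>a\<^sub>i ^ q\<close>, which are polynomial in the remaining generators up
  to a denominator \<open>M\<close> without zeros. Vanishing of \<open>P\<close> at a point is required to be invariant
  under conjugation; this property passes to \<open>R\<close> and permits the next elimination.
\<close>
lemma eliminate_puiseux_coeff:
  assumes "b ! 0 > 0"
    and P: "P \<in> polyfuns (parametrised_branches b) (coeff_funs (Suc i))"
    and inv: "\<And>x \<epsilon>. x \<in> parametrised_branches b \<Longrightarrow> \<epsilon> ^ (b ! 0) = 1 \<Longrightarrow> P (conj_act \<epsilon> x) = 0 \<longleftrightarrow> P x = 0"
  shows "\<exists>R \<in> polyfuns (parametrised_branches b) (coeff_funs i).
    \<forall>x\<in>parametrised_branches b. R x = 0 \<longleftrightarrow> P x = 0"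
proof -
  let ?D = "parametrised_branches b" and ?e = "gcd_below b i"
  let ?H = "{\<epsilon>::complex. \<epsilon> ^ ?e = 1}"
  define a where "a = (\<lambda>x :: complex fps poly \<times> complex fps. fps_nth (snd x) i)"
  define M where "M = (\<lambda>x :: complex fps poly \<times> complex fps. cofactor_coeff b i (snd x))"
  have e: "?e > 0" using gcd_below_pos[OF assms(1)] .
  have fin: "finite ?H" using finite_roots_unity[of ?e] e by simp
  have H: "\<epsilon> ^ (b ! 0) = 1" if "\<epsilon> \<in> ?H" for \<epsilon>
    using that root_gcd_below_iff[OF assms(1), of \<epsilon> i] by simp
  have gens: "coeff_funs (Suc i) = insert a (coeff_funs i)"
    by (simp add: coeff_funs_Suc a_def case_prod_unfold)
  have a_act: "a (conj_act \<epsilon> x) = \<epsilon> ^ i * a x" for \<epsilon> x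
    by (simp add: a_def conj_act_def case_prod_unfold)
  have act: "h (conj_act \<epsilon> x) = h x" if "h \<in> polyfuns ?D (coeff_funs i)" "\<epsilon> \<in> ?H" "x \<in> ?D" for h \<epsilon> x
    using polyfuns_conj_invariant[OF that(1) that(3) assms(1)] that(2) by simp
  have M: "M \<in> polyfuns ?D (coeff_funs i)" "\<And>x. x \<in> ?D \<Longrightarrow> M x \<noteq> 0"
    using cofactor_coeff_polyfuns[OF assms(1)] cofactor_coeff_nonzero
    by (auto simp: M_def case_prod_unfold parametrised_branches_def)
  obtain q where q: "q > 0" "\<And>j. ?e dvd i * j \<longleftrightarrow> q dvd j"
    "(\<lambda>x. M x * a x ^ q) \<in> polyfuns ?D (coeff_funs i)"
    using puiseux_coeff_power_polyfuns[OF assms(1), of i] by (auto simp: M_def a_def case_prod_unfold)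

  \<comment> \<open>The norm of \<open>P\<close> over the stabiliser of the earlier Puiseux coefficients.\<close>
  define R where "R x = (\<Prod>\<epsilon>\<in>?H. P (conj_act \<epsilon> x))" for x
  have R_zero: "R x = 0 \<longleftrightarrow> P x = 0" if "x \<in> ?D" for x
  proof -
    have "R x = 0 \<longleftrightarrow> (\<exists>\<epsilon>\<in>?H. P (conj_act \<epsilon> x) = 0)"
      unfolding R_def by (rule prod_zero_iff[OF fin])
    also have "\<dots> \<longleftrightarrow> (\<exists>\<epsilon>\<in>?H. P x = 0)" using inv[OF that] H by blast
    also have "\<dots> \<longleftrightarrow> P x = 0" by (auto intro: exI[of _ 1])
    finally show ?thesis .
  qed
  have R_inv: "R (conj_act \<eta> x) = R x" if "\<eta> \<in> ?H" for \<eta> x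
  proof -
    have "\<eta> \<noteq> 0" using that e by (auto simp: zero_power)
    have "R (conj_act \<eta> x) = (\<Prod>\<epsilon>\<in>?H. P (conj_act (\<epsilon> * \<eta>) x))"
      by (simp add: R_def conj_act_def case_prod_unfold twist_twist)
    also have "\<dots> = R x" unfolding R_def
      by (rule prod.reindex_bij_witness[of _ "\<lambda>\<epsilon>. \<epsilon> / \<eta>" "\<lambda>\<epsilon>. \<epsilon> * \<eta>"])
         (use that \<open>\<eta> \<noteq> 0\<close> in \<open>auto simp: power_mult_distrib power_divide\<close>)
    finally show ?thesis .
  qed
  have R_mem: "R \<in> polyfuns ?D (insert a (coeff_funs i))"
  proof -
    obtain p and d :: nat where p: "\<And>j. p j \<in> polyfuns ?D (coeff_funs i)"
      "\<And>x. x \<in> ?D \<Longrightarrow> P x = (\<Sum>j\<le>d. p j x * a x ^ j)"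
      using polyfuns_insert_expand[OF P[unfolded gens]] by blast
    have "(\<lambda>x. \<Prod>\<epsilon>\<in>?H. \<Sum>j\<le>d. p j x * (\<epsilon> ^ i * a x) ^ j) \<in> polyfuns ?D (insert a (coeff_funs i))"
      by (intro polyfuns_prod polyfuns_sum polyfuns.mult polyfuns_power polyfuns.const
           polyfuns_mono[OF p(1)] polyfuns.gen) auto
    then show ?thesis
    proof (rule polyfuns.cong)
      fix x assume x: "x \<in> ?D"
      have "P (conj_act \<epsilon> x) = (\<Sum>j\<le>d. p j x * (\<epsilon> ^ i * a x) ^ j)" if "\<epsilon> \<in> ?H" for \<epsilon>
        using p(2)[OF conj_act_mem[OF x H[OF that]]] act[OF p(1) that x] by (simp add: a_act)
      then show "R x = (\<Prod>\<epsilon>\<in>?H. \<Sum>j\<le>d. p j x * (\<epsilon> ^ i * a x) ^ j)"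
        unfolding R_def by (intro prod.cong) auto
    qed
  qed
  obtain r and d :: nat where r: "\<And>j. r j \<in> polyfuns ?D (coeff_funs i)"
    "\<And>x. x \<in> ?D \<Longrightarrow> R x = (\<Sum>j\<le>d. r j x * a x ^ j)"
    using polyfuns_insert_expand[OF R_mem] by blast
  have R_avg: "R x = (\<Sum>j\<le>d. if q dvd j then r j x * (a x ^ q) ^ (j div q) else 0)" if x: "x \<in> ?D" for x
  proof -
    \<comment> \<open>Averaging kills the terms whose exponent is not a multiple of \<open>q\<close>, by orthogonality.\<close>
    have "of_nat ?e * R x = (\<Sum>\<epsilon>\<in>?H. R (conj_act \<epsilon> x))"
      using R_inv card_roots_unity_eq[OF e] by simp
    also have "\<dots> = (\<Sum>\<epsilon>\<in>?H. \<Sum>j\<le>d. r j x * a x ^ j * \<epsilon> ^ (i * j))"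
    proof (intro sum.cong refl)
      fix \<epsilon> assume \<epsilon>: "\<epsilon> \<in> ?H"
      have "(\<epsilon> ^ i * a x) ^ j = a x ^ j * \<epsilon> ^ (i * j)" for j
        by (simp add: power_mult_distrib power_mult)
      then show "R (conj_act \<epsilon> x) = (\<Sum>j\<le>d. r j x * a x ^ j * \<epsilon> ^ (i * j))"
        using r(2)[OF conj_act_mem[OF x H[OF \<epsilon>]]] act[OF r(1) \<epsilon> x] by (simp add: a_act mult.assoc)
    qed
    also have "\<dots> = (\<Sum>j\<le>d. r j x * a x ^ j * (\<Sum>\<epsilon>\<in>?H. \<epsilon> ^ (i * j)))"
      by (subst sum.swap) (simp add: sum_distrib_left)
    also have "\<dots> = of_nat ?e * (\<Sum>j\<le>d. if q dvd j then r j x * (a x ^ q) ^ (j div q) else 0)"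
      unfolding sum_roots_of_unity_power[OF e] q(2) sum_distrib_left
      by (intro sum.cong refl) (auto simp flip: power_mult)
    finally show ?thesis using e by simp
  qed
  have "R \<in> polyfuns ?D (insert (\<lambda>x. 1 / M x) (coeff_funs i))" (is "_ \<in> ?A")
  proof -
    have sub: "h \<in> ?A" if "h \<in> polyfuns ?D (coeff_funs i)" for h
      using that by (rule polyfuns_mono) auto
    have "(\<lambda>x. (1 / M x) * (M x * a x ^ q)) \<in> ?A"
      by (intro polyfuns.mult sub q polyfuns.gen) simp
    then have aq: "(\<lambda>x. a x ^ q) \<in> ?A"
      by (rule polyfuns.cong) (use M(2) in auto)
    have "(\<lambda>x. if q dvd j then r j x * (a x ^ q) ^ (j div q) else 0) \<in> ?A" for j
      using polyfuns.mult[OF sub[OF r(1)] polyfuns_power[OF aq]] polyfuns.const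
      by (cases "q dvd j") simp_all
    then have "(\<lambda>x. \<Sum>j\<le>d. if q dvd j then r j x * (a x ^ q) ^ (j div q) else 0) \<in> ?A"
      by (intro polyfuns_sum)
    then show ?thesis by (rule polyfuns.cong) (rule R_avg)
  qed
  then obtain N where N: "(\<lambda>x. M x ^ N * R x) \<in> polyfuns ?D (coeff_funs i)"
    using polyfuns_clear_denominator[OF _ M] by blast
  show ?thesis
    by (rule bexI[OF _ N]) (use M(2) R_zero in auto)
qed

lemma eliminate_all_puiseux_coeffs:
  assumes "b ! 0 > 0"
    and "P \<in> polyfuns (parametrised_branches b) (coeff_funs i)"
    and "\<And>x \<epsilon>. x \<in> parametrised_branches b \<Longrightarrow> \<epsilon> ^ (b ! 0) = 1 \<Longrightarrow> P (conj_act \<epsilon> x) = 0 \<longleftrightarrow> P x = 0"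
  shows "\<exists>R \<in> polyfuns (parametrised_branches b) (coeff_funs 0).
    \<forall>x\<in>parametrised_branches b. R x = 0 \<longleftrightarrow> P x = 0"
  using assms(2,3)
proof (induction i arbitrary: P)
  case (Suc i)
  obtain P' where P': "P' \<in> polyfuns (parametrised_branches b) (coeff_funs i)"
    "\<And>x. x \<in> parametrised_branches b \<Longrightarrow> P' x = 0 \<longleftrightarrow> P x = 0"
    using eliminate_puiseux_coeff[OF assms(1) Suc.prems] by blast
  have "\<exists>R \<in> polyfuns (parametrised_branches b) (coeff_funs 0).
    \<forall>x\<in>parametrised_branches b. R x = 0 \<longleftrightarrow> P' x = 0"
    by (rule Suc.IH[OF P'(1)]) (simp add: P'(2) Suc.prems(2) conj_act_mem)
  then show ?case using P'(2) by auto
qed blast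

theorem theorem3:
  fixes b :: "nat list" and n :: nat and J :: "nat set" and Q :: "nat cpoly"
  assumes "char_seq b" and "b ! 0 = n"
    and "finite J" and "J \<subseteq> index_set b"
    and "cpoly_vars Q \<subseteq> J"
    and "\<forall>\<epsilon>\<in>{z::complex. z ^ n = 1}. \<forall>a :: nat \<Rightarrow> complex.
           cpoly_eval Q a = 0 \<longleftrightarrow> cpoly_eval Q (\<lambda>i. \<epsilon> ^ i * a i) = 0"
  shows "\<exists>(\<Gamma> :: (nat \<times> nat) set) (W :: (nat \<times> nat) cpoly).
           finite \<Gamma> \<and> cpoly_vars W \<subseteq> \<Gamma> \<and>
           (\<forall>f\<in>branches b. \<forall>\<alpha>. puiseux_parametrisation_of_curve f n \<alpha> \<longrightarrow>
              (cpoly_eval Q (fps_nth \<alpha>) = 0 \<longleftrightarrow> cpoly_eval W (coeff_XY f) = 0))"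
proof -
  let ?D = "parametrised_branches b"
  have n: "b ! 0 > 0" using assms(1) by (auto simp: char_seq_def)
  define m where "m = Suc (Max (insert 0 J))"
  have m: "j < m" if "j \<in> cpoly_vars Q" for j
    unfolding m_def less_Suc_eq_le using that assms(3,5) by (intro Max_ge) auto
  define P where "P = (\<lambda>x :: complex fps poly \<times> complex fps. cpoly_eval Q (fps_nth (snd x)))"
  have "(\<lambda>v x. fps_nth (snd x) v) ` cpoly_vars Q \<subseteq> coeff_funs m"
    using m unfolding coeff_funs_def case_prod_unfold by blast
  then have "P \<in> polyfuns ?D (coeff_funs m)"
    unfolding P_def by (rule polyfuns_mono[OF cpoly_eval_in_polyfuns[of Q "\<lambda>x. fps_nth (snd x)"]])
  then have "\<exists>R \<in> polyfuns ?D (coeff_funs 0). \<forall>x\<in>?D. R x = 0 \<longleftrightarrow> P x = 0"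
  proof (rule eliminate_all_puiseux_coeffs[OF n])
    fix x :: "complex fps poly \<times> complex fps" and \<epsilon> :: complex assume "\<epsilon> ^ (b ! 0) = 1"
    moreover have "fps_nth (snd (conj_act \<epsilon> x)) = (\<lambda>i. \<epsilon> ^ i * fps_nth (snd x) i)"
      by (auto simp: conj_act_def case_prod_unfold)
    ultimately show "P (conj_act \<epsilon> x) = 0 \<longleftrightarrow> P x = 0"
      using assms(2) assms(6)[rule_format, of \<epsilon> "fps_nth (snd x)"] by (simp add: P_def)
  qed
  then obtain R where R: "R \<in> polyfuns ?D (coeff_funs 0)"
    "\<And>x. x \<in> ?D \<Longrightarrow> R x = 0 \<longleftrightarrow> cpoly_eval Q (fps_nth (snd x)) = 0"
    unfolding P_def by blast

  \<comment> \<open>It remains to replace the coefficients of \<open>w\<close> by those of \<open>f\<close>. The points are now triples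
     \<open>(f, w, \<alpha>)\<close>, on which \<open>c\<^bsub>0n\<^esub>\<close> has no zeros.\<close>
  define E where "E = {(f, w, \<alpha>). is_weierstrass_poly_of f w \<and> (w, \<alpha>) \<in> ?D}"
  let ?c = "\<lambda>x :: complex fps fps \<times> complex fps poly \<times> complex fps. coeff_XY (fst x)"
  have E: "weierstrass_poly n (fst (snd x))" "j < n \<Longrightarrow> ?c x (0, j) = 0" "?c x (0, n) \<noteq> 0"
    "\<exists>u. u dvd 1 \<and> fst x = u * fps_of_poly (fst (snd x))" if "x \<in> E" for x j
  proof -
    obtain f w \<alpha> where x: "x = (f, w, \<alpha>)" by (cases x)
    have w: "weierstrass_poly n w" "is_weierstrass_poly_of f w"
      using that assms(2) by (auto simp: E_def x parametrised_branches_def puiseux_parametrisation_of_def)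
    then obtain m where m: "\<forall>j<m. coeff_XY f (0, j) = 0" "coeff_XY f (0, m) \<noteq> 0"
      "weierstrass_poly m w" "\<exists>u. u dvd 1 \<and> f = u * fps_of_poly w"
      unfolding is_weierstrass_poly_of_def by blast
    have "m = n" using w m by (simp add: weierstrass_poly_def)
    then show "weierstrass_poly n (fst (snd x))" "j < n \<Longrightarrow> ?c x (0, j) = 0" "?c x (0, n) \<noteq> 0"
      "\<exists>u. u dvd 1 \<and> fst x = u * fps_of_poly (fst (snd x))" using m by (auto simp: x)
  qed
  have "(\<lambda>x. R (snd x)) \<in> polyfuns E (insert (\<lambda>x. 1 / ?c x (0, n)) (range (\<lambda>\<gamma> x. ?c x \<gamma>)))"
  proof (rule polyfuns_pullback[OF R(1)])
    show "snd ` E \<subseteq> ?D" by (auto simp: E_def)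
    fix g assume "g \<in> coeff_funs 0"
    then obtain k m where g: "g = (\<lambda>(w, \<alpha>). fps_nth (coeff w k) m)" by (auto simp: coeff_funs_def)
    show "(\<lambda>x. g (snd x)) \<in> polyfuns E (insert (\<lambda>x. 1 / ?c x (0, n)) (range (\<lambda>\<gamma> x. ?c x \<gamma>)))"
      unfolding g case_prod_unfold by (rule weierstrass_coeffs_polyfuns) (use E in auto)
  qed
  then obtain N where "(\<lambda>x. ?c x (0, n) ^ N * R (snd x)) \<in> polyfuns E (range (\<lambda>\<gamma> x. ?c x \<gamma>))"
    by (rule polyfuns_clear_denominator) (use E(3) in \<open>auto intro: polyfuns.gen\<close>)
  then have "\<exists>W. \<forall>x\<in>E. ?c x (0, n) ^ N * R (snd x) = cpoly_eval W (?c x)"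
    by (rule polyfuns_imp_cpoly)
  then obtain W where W: "\<And>x. x \<in> E \<Longrightarrow> ?c x (0, n) ^ N * R (snd x) = cpoly_eval W (?c x)"
    by blast
  have "cpoly_eval Q (fps_nth \<alpha>) = 0 \<longleftrightarrow> cpoly_eval W (coeff_XY f) = 0"
    if f: "f \<in> branches b" and \<alpha>: "puiseux_parametrisation_of_curve f n \<alpha>" for f \<alpha>
  proof -
    \<comment> \<open>The characteristic is known for one parametrisation of \<open>w\<close>; it carries over to \<open>\<alpha>\<close>, which is a
       conjugate.\<close>
    obtain w where w: "is_weierstrass_poly_of f w" "puiseux_parametrisation_of w n \<alpha>"
      using \<alpha> by (auto simp: puiseux_parametrisation_of_curve_def)
    obtain w' where w': "is_weierstrass_poly_of f w'" "w' \<in> branch_polys b"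
      using f by (auto simp: branches_def)
    then obtain \<beta> where \<beta>: "puiseux_parametrisation_of w n \<beta>" "has_characteristic n \<beta> b"
      using is_weierstrass_poly_of_unique[OF w(1) w'(1)] assms(2) by (auto simp: branch_polys_def)
    obtain \<epsilon> where \<epsilon>: "\<epsilon> ^ n = 1" "\<alpha> = twist \<epsilon> \<beta>"
      using puiseux_parametrisations_conjugate[OF \<beta>(1) w(2)] .
    have "\<epsilon> \<noteq> 0" using \<epsilon>(1) n assms(2) by (auto simp: zero_power)
    then have "has_characteristic n \<alpha> b" using \<beta>(2) \<epsilon>(2) by (simp add: has_characteristic_twist)
    then have D: "(w, \<alpha>) \<in> ?D" using w(2) assms(2) by (simp add: parametrised_branches_def)
    then have "(f, w, \<alpha>) \<in> E" using w(1) by (simp add: E_def)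
    then show ?thesis using W[of "(f, w, \<alpha>)"] E(3)[of "(f, w, \<alpha>)"] R(2)[OF D] by auto
  qed
  moreover have "finite (cpoly_vars W)" by (simp add: cpoly_vars_def)
  ultimately show ?thesis by blast
qed

end
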